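(* Let $\rho\in(\tfrac12,1)$ and $\beta>2$. The function $\psi_\rho$, restricted to points where $x>y>0$, fails to be differentiable along the lines $$y=\frac{x}{k+1},\quad k\in\mathbb N,$$ and $y=x$, $y=0$. Furthermore, $\psi_\rho$ is piecewise affine.
   Context: $\mathbb N=\{1,2,3,\dots\}$. Let $\rho\in(\tfrac12,1)$, $\beta>2$. Let $a_\rho:\mathbb R^2\to\{1,\beta\}$ be the $\mathbb Z^2$-periodic function with $a_\rho(x,y)=\beta$ if $(x,y)\in\left(\tfrac{1-\rho}{2},\tfrac{1+\rho}{2}\right)^2$ and $a_\rho(x,y)=1$ for all other $(x,y)\in[0,1]^2$. The limit metric $\psi_\rho:\mathbb R^2\to\mathbb R$ is $$\psi_\rho(\xi)=\lim_{\varepsilon\to0}\inf\left\{\int_0^1a_\rho\!\left(\frac{\gamma(\tau)}{\varepsilon}\right)\|\gamma'(\tau)\|\,d\tau:\gamma\in W^{1,1}((0,1);\mathbb R^2),\ \gamma(0)=0,\ \gamma(1)=\xi\right\},$$ where $\|\cdot\|$ is the Euclidean norm; the limit is known to exist, and $\psi_\rho$ is convex with $\|\xi\|\le\psi_\rho(\xi)\le\beta\|\xi\|$. *)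

theory Defs
  imports "HOL-Analysis.Analysis"
begin

text \<open>
  The plane is the product type \<open>real \<times> real\<close>, whose library norm is the Euclidean one.
\<close>

definition coeff_fun :: "real \<Rightarrow> real \<Rightarrow> real \<times> real \<Rightarrow> real" where
  "coeff_fun \<rho> \<beta> z =
     (if frac (fst z) \<in> {(1 - \<rho>) / 2<..<(1 + \<rho>) / 2} \<and>
         frac (snd z) \<in> {(1 - \<rho>) / 2<..<(1 + \<rho>) / 2}
      then \<beta> else 1)"

text \<open>
  \<open>test_fun \<phi> \<phi>'\<close>: \<open>\<phi>\<close> is a test function in \<open>C\<^sub>c\<^sup>1(0,1)\<close>, with derivative \<open>\<phi>'\<close>. In dimension one,
  testing against \<open>C\<^sub>c\<^sup>1\<close> rather than smooth functions is the convention of Brezis' textbook.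
\<close>

definition test_fun :: "(real \<Rightarrow> real) \<Rightarrow> (real \<Rightarrow> real) \<Rightarrow> bool" where
  "test_fun \<phi> \<phi>' \<longleftrightarrow>
     (\<forall>t. (\<phi> has_real_derivative \<phi>' t) (at t)) \<and>
     continuous_on UNIV \<phi>' \<and>
     closure {t. \<phi> t \<noteq> 0} \<subseteq> {0<..<1}"

text \<open>
  \<open>sobolev_path \<gamma> g\<close>: \<open>\<gamma>\<close> is (the representative, continuous on \<open>[0,1]\<close>, of) an element of
  \<open>W\<^sup>1\<^sup>,\<^sup>1((0,1); \<real>\<^sup>2)\<close>, and \<open>g\<close> is its weak derivative. The values \<open>\<gamma> 0\<close> and \<open>\<gamma> 1\<close> of this
  representative are what the boundary conditions refer to. Integrability of \<open>\<gamma>\<close> follows from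
  continuity.
\<close>

definition sobolev_path :: "(real \<Rightarrow> real \<times> real) \<Rightarrow> (real \<Rightarrow> real \<times> real) \<Rightarrow> bool" where
  "sobolev_path \<gamma> g \<longleftrightarrow>
     continuous_on {0..1} \<gamma> \<and>
     g absolutely_integrable_on {0<..<1} \<and>
     (\<forall>\<phi> \<phi>'. test_fun \<phi> \<phi>' \<longrightarrow>
        (LINT t:{0<..<1}|lebesgue. \<phi>' t *\<^sub>R \<gamma> t) =
        - (LINT t:{0<..<1}|lebesgue. \<phi> t *\<^sub>R g t))"

definition scaled_dist :: "real \<Rightarrow> real \<Rightarrow> real \<Rightarrow> real \<times> real \<Rightarrow> real" where
  "scaled_dist \<rho> \<beta> \<epsilon> \<xi> =
     Inf {LINT t:{0<..<1}|lebesgue. coeff_fun \<rho> \<beta> (\<gamma> t /\<^sub>R \<epsilon>) * norm (g t) |\<gamma> g.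
            sobolev_path \<gamma> g \<and> \<gamma> 0 = 0 \<and> \<gamma> 1 = \<xi>}"

definition limit_metric :: "real \<Rightarrow> real \<Rightarrow> real \<times> real \<Rightarrow> real" where
  "limit_metric \<rho> \<beta> \<xi> = Lim (at_right 0) (\<lambda>\<epsilon>. scaled_dist \<rho> \<beta> \<epsilon> \<xi>)"

text \<open>
  A piecewise affine function is affine on each piece of a covering of the plane by countably many
  closed convex polyhedra. Infinitely many pieces have to be allowed, and the covering cannot be
  required to be locally finite: the kinks of the limit metric along \<open>y = x / (k + 1)\<close>
  accumulate at the axis \<open>y = 0\<close>. For the same reason lower-dimensional pieces are allowed (a point
  of that axis other than the origin lies in no two-dimensional piece). As there are only countably
  many pieces and all are closed, the interiors of the two-dimensional ones are dense.
\<close>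

definition piecewise_affine :: "(real \<times> real \<Rightarrow> real) \<Rightarrow> bool" where
  "piecewise_affine f \<longleftrightarrow>
     (\<exists>\<P>. countable \<P> \<and> (\<forall>P\<in>\<P>. polyhedron P) \<and> \<Union>\<P> = UNIV \<and>
        (\<forall>P\<in>\<P>. \<exists>a b. \<forall>z\<in>P. f z = a \<bullet> z + b))"

end

theory Submission
  imports Defs
begin

text \<open>
  Crossing an obstacle never beats walking around it, because the detour is at most twice as long
  and \<open>\<beta> > 2\<close>. Hence the limit metric is the stable norm of the length metric on the complement of
  the obstacles, whose geodesics turn at obstacle corners. On the cone spanned by \<open>(k + 1, 1)\<close> and
  \<open>(k + 2, 1)\<close> it is linear: polygonal paths through the corners give the upper bound. For the lower
  bound one prescribes a potential on the gates between the horizontal strips and the vertical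
  blocks of the free region, checks that it is 1-Lipschitz within each strip and each block, and
  extends it by McShane's formula, 1-Lipschitz on these pieces and \<open>\<beta>\<close>-Lipschitz on the obstacles.
  Such a calibration differs from the linear function by a bounded amount, and its increments bound
  the cost of every path from below. The slopes of adjacent cones differ by strict convexity of
  \<open>x \<mapsto> sqrt (x\<^sup>2 + (1 - \<rho>)\<^sup>2)\<close>.
\<close>

section \<open>Sobolev paths\<close>

text \<open>Strips and blocks are convex, so inside one of them the Euclidean distance is the right
  bound for the potential. On the whole free region that bound would be too strong: along a cone the
  linear function to be calibrated grows faster than the distance. Hence the potential is glued from
  pieces, and the estimate along paths is local. The data on the gates are nearly forced. For paths
  repeating the step \<open>(k + 1, 1)\<close> and for paths repeating \<open>(k + 2, 1)\<close> the
  calibration has to be sharp, which fixes the values at the corners and with them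
  \<open>p k\<close>, \<open>q k\<close> and \<open>tau k\<close>. What remains free is the profile
  along a gate: the strip bounds it from above, and \<open>h k\<close> is the largest profile
  vanishing at 0 that respects this bound; the block needs a profile that rises fast enough. The
  delicate case is a strip crossed against the direction of the optimal path. It needs a
  quantitative form of \<open>p 0 < 1\<close> and the bound \<open>1 / 2 < \<rho>\<close>. All
  errors are bounded at unit scale, hence of order \<open>\<epsilon>\<close> after scaling, so
  existence and value of the limit come together.\<close>

lemma has_real_derivative_pos_part_square:
  "((\<lambda>x::real. (max 0 x)\<^sup>2) has_real_derivative 2 * max 0 x) (at x)"
proof (cases "x = 0")
  case True
  have "((\<lambda>h::real. max 0 h) \<longlongrightarrow> max 0 0) (at 0)"
    by (intro tendsto_intros)
  moreover have "max 0 h = ((max 0 h)\<^sup>2 - (max 0 0)\<^sup>2) / h" for h :: real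
    by (auto simp: max_def power2_eq_square)
  ultimately show ?thesis
    using True by (simp add: DERIV_def)
next
  case False
  show ?thesis
  proof (cases "x > 0")
    case True
    have "((\<lambda>x::real. x\<^sup>2) has_real_derivative 2 * x) (at x)"
      by (auto intro!: derivative_eq_intros)
    then have "((\<lambda>x::real. (max 0 x)\<^sup>2) has_real_derivative 2 * x) (at x)"
      by (rule has_field_derivative_transform_within_open[where S = "{0<..}"])
         (use True in \<open>auto simp: max_def\<close>)
    then show ?thesis using True by simp
  next
    case neg: False
    have "((\<lambda>x::real. 0) has_real_derivative 0) (at x)"
      by simp
    then have "((\<lambda>x::real. (max 0 x)\<^sup>2) has_real_derivative 0) (at x)"
      by (rule has_field_derivative_transform_within_open[where S = "{..<0}"])
         (use neg \<open>x \<noteq> 0\<close> in \<open>auto simp: max_def\<close>)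
    then show ?thesis using neg by simp
  qed
qed

text \<open>A quadratic spline climbing from 0 to 1 on \<open>{0..1}\<close>, written with truncated
  powers. It is continuously differentiable, as \<open>test_fun\<close> asks, and its derivative
  \<open>tent\<close> is explicit.\<close>

definition smooth_step :: "real \<Rightarrow> real" where
  "smooth_step x = 2 * ((max 0 x)\<^sup>2 - 2 * (max 0 (x - 1/2))\<^sup>2 + (max 0 (x - 1))\<^sup>2)"

definition tent :: "real \<Rightarrow> real" where
  "tent x = 4 * (max 0 x - 2 * max 0 (x - 1/2) + max 0 (x - 1))"

lemma smooth_step_deriv: "(smooth_step has_real_derivative tent x) (at x)"
proof -
  have D: "((\<lambda>x. (max 0 (x - c))\<^sup>2) has_real_derivative 2 * max 0 (x - c)) (at x)" for c
    by (rule DERIV_chain2[where g = "\<lambda>x. x - c" and Db = 1,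
          OF has_real_derivative_pos_part_square, THEN DERIV_cong])
       (auto intro!: derivative_eq_intros)
  show ?thesis
    unfolding smooth_step_def tent_def
    by (rule derivative_eq_intros D[of 0, simplified] D refl | simp)+
qed

lemma smooth_step_eq_0: "x \<le> 0 \<Longrightarrow> smooth_step x = 0"
  by (simp add: smooth_step_def)

lemma smooth_step_eq_1: "1 \<le> x \<Longrightarrow> smooth_step x = 1"
  by (simp add: smooth_step_def max_def power2_eq_square algebra_simps)

lemma tent_nonneg: "0 \<le> tent x"
  by (auto simp: tent_def max_def)

lemma tent_eq_0: "x \<le> 0 \<or> 1 \<le> x \<Longrightarrow> tent x = 0"
  by (auto simp: tent_def max_def)

lemma continuous_tent: "continuous_on A tent"
  unfolding tent_def by (intro continuous_intros)

lemma smooth_step_range: "0 \<le> smooth_step x" "smooth_step x \<le> 1"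
proof -
  have mono: "smooth_step x \<le> smooth_step y" if "x \<le> y" for x y
    by (rule DERIV_nonneg_imp_nondecreasing[OF that]) (use smooth_step_deriv tent_nonneg in blast)
  show "0 \<le> smooth_step x"
    using mono[of "min x 0" x] smooth_step_eq_0[of "min x 0"] by simp
  show "smooth_step x \<le> 1"
    using mono[of x "max x 1"] smooth_step_eq_1[of "max x 1"] by simp
qed

lemma has_integral_tent:
  assumes "d > 0"
  shows "((\<lambda>x. tent ((x - s) / d) / d) has_integral 1) {s..s + d}"
proof -
  have "((\<lambda>x. smooth_step ((x - s) / d)) has_real_derivative tent ((x - s) / d) / d) (at x)" for x
    using assms
    by (intro DERIV_chain2[where g = "\<lambda>x. (x - s) / d" and Db = "1 / d",
          OF smooth_step_deriv, THEN DERIV_cong])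
       (auto intro!: derivative_eq_intros)
  then have "((\<lambda>x. tent ((x - s) / d) / d) has_integral
      smooth_step ((s + d - s) / d) - smooth_step ((s - s) / d)) {s..s+d}"
    using assms
    by (intro fundamental_theorem_of_calculus)
       (auto simp: has_real_derivative_iff_has_vector_derivative[symmetric] intro: has_field_derivative_at_within)
  then show ?thesis using assms by (simp add: smooth_step_eq_0 smooth_step_eq_1)
qed

text \<open>The rescaled tent is a probability density on \<open>{s..s + d}\<close>, so the integral
  is a weighted mean of values close to \<open>\<gamma> s\<close>.\<close>

lemma norm_integral_tent_diff_le:
  fixes \<gamma> :: "real \<Rightarrow> 'a::euclidean_space"
  assumes "d > 0" and cont: "continuous_on {s..s+d} \<gamma>"
    and close: "\<And>x. x \<in> {s..s+d} \<Longrightarrow> norm (\<gamma> x - \<gamma> s) \<le> e"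
  shows "norm (integral {s..s+d} (\<lambda>x. (tent ((x - s) / d) / d) *\<^sub>R \<gamma> x) - \<gamma> s) \<le> e"
proof -
  have T: "((\<lambda>x. tent ((x - s) / d) / d) has_integral 1) {s..s + d}"
    using has_integral_tent assms by auto
  have c: "continuous_on {s..s+d} (\<lambda>x. tent ((x - s) / d) / d)"
    using assms by (intro continuous_intros continuous_on_compose2[OF continuous_tent]) auto
  have i1: "(\<lambda>x. (tent ((x - s) / d) / d) *\<^sub>R \<gamma> x) integrable_on {s..s+d}"
    by (intro integrable_continuous_interval continuous_intros c cont)
  have "((\<lambda>x. (tent ((x - s) / d) / d) *\<^sub>R \<gamma> s) has_integral 1 *\<^sub>R \<gamma> s) {s..s+d}"
    using T by (rule has_integral_scaleR_left)
  then have eq: "integral {s..s+d} (\<lambda>x. (tent ((x - s) / d) / d) *\<^sub>R \<gamma> x) - \<gamma> s =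
      integral {s..s+d} (\<lambda>x. (tent ((x - s) / d) / d) *\<^sub>R (\<gamma> x - \<gamma> s))"
    using i1 by (simp add: scaleR_diff_right integral_diff has_integral_iff)
  have "norm (integral {s..s+d} (\<lambda>x. (tent ((x - s) / d) / d) *\<^sub>R (\<gamma> x - \<gamma> s)))
      \<le> integral {s..s+d} (\<lambda>x. (tent ((x - s) / d) / d) * e)"
  proof (rule integral_norm_bound_integral)
    show "(\<lambda>x. (tent ((x - s) / d) / d) *\<^sub>R (\<gamma> x - \<gamma> s)) integrable_on {s..s+d}"
      by (intro integrable_continuous_interval continuous_intros c cont)
    show "(\<lambda>x. (tent ((x - s) / d) / d) * e) integrable_on {s..s+d}"
      by (intro integrable_continuous_interval continuous_intros c)
    show "norm ((tent ((x - s) / d) / d) *\<^sub>R (\<gamma> x - \<gamma> s)) \<le> tent ((x - s) / d) / d * e"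
      if "x \<in> {s..s+d}" for x
      using close[OF that] assms(1) tent_nonneg[of "(x - s) / d"]
      by (auto intro!: mult_mono divide_right_mono)
  qed
  also have "\<dots> = e"
    using has_integral_mult_left[OF T, of e] by (simp add: has_integral_iff)
  finally show ?thesis using eq by simp
qed

lemma absolutely_integrable_continuous_scaleR:
  fixes g :: "real \<Rightarrow> real \<times> real"
  assumes "continuous_on {0..1} \<phi>" "g absolutely_integrable_on {0<..<1}"
  shows "(\<lambda>x. \<phi> x *\<^sub>R g x) absolutely_integrable_on {0<..<1}"
proof (rule absolutely_integrable_bounded_measurable_product
        [where h = "\<lambda>(x::real) (y::real \<times> real). x *\<^sub>R y" and f = \<phi> and g = g])
  show "bilinear (\<lambda>(x::real) (y::real \<times> real). x *\<^sub>R y)"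
    by (simp add: bilinear_conv_bounded_bilinear bounded_bilinear_scaleR)
  show "\<phi> \<in> borel_measurable (lebesgue_on {0<..<1})"
    by (intro continuous_imp_measurable_on_sets_lebesgue continuous_on_subset[OF assms(1)]) auto
  show "bounded (\<phi> ` {0<..<1})"
    by (rule bounded_subset[OF compact_imp_bounded[OF compact_continuous_image[OF assms(1) compact_Icc]]]) auto
qed (use assms in auto)

text \<open>
  Testing against smoothed indicators of \<open>{a<..b}\<close> recovers the fundamental theorem of calculus from
  the weak formulation.
\<close>

lemma sobolev_path_has_integral:
  assumes sp: "sobolev_path \<gamma> g" and st: "0 \<le> s" "s \<le> t" "t \<le> 1"
  shows "(g has_integral \<gamma> t - \<gamma> s) {s..t}"
proof -
  have cont: "continuous_on {0..1} \<gamma>" and g0: "g absolutely_integrable_on {0<..<1}"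
    and weak: "\<And>\<phi> \<phi>'. test_fun \<phi> \<phi>' \<Longrightarrow>
        (LINT t:{0<..<1}|lebesgue. \<phi>' t *\<^sub>R \<gamma> t) = - (LINT t:{0<..<1}|lebesgue. \<phi> t *\<^sub>R g t)"
    using sp by (auto simp: sobolev_path_def)
  have g1: "g absolutely_integrable_on {0..1}"
    using g0 absolutely_integrable_on_open_interval[of 0 1 g] by (simp add: box_real cbox_interval)
  have gint: "g integrable_on {a..b}" if "0 \<le> a" "b \<le> 1" for a b
    using that absolutely_integrable_on_def g1 integrable_on_subinterval
    by (metis atLeastatMost_subset_iff)
  have inner: "integral {a..b} g = \<gamma> b - \<gamma> a" if ab: "0 < a" "a < b" "b < 1" for a b
  proof -
    define D where "D = min (1 - b) (b - a)"
    have D: "D > 0" using ab by (simp add: D_def)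
    \<comment> \<open>The shift by 2 makes every \<open>d n\<close>, the one for
      \<open>n = 0\<close> included, strictly smaller than \<open>D\<close>; the ramps of the test
      functions then stay inside the open unit interval.\<close>
    define d where "d n = D / (real n + 2)" for n :: nat
    have d: "0 < d n" "d n < 1 - b" "d n < b - a" for n
    proof -
      have "D / (real n + 2) < D / 1"
        using D by (intro divide_strict_left_mono) auto
      then show "0 < d n" "d n < 1 - b" "d n < b - a"
        using D by (auto simp: d_def D_def)
    qed
    have dlim: "d \<longlonglongrightarrow> 0"
      using LIMSEQ_ignore_initial_segment[OF lim_const_over_n, of D 2] by (simp add: d_def[abs_def] add.commute)
    \<comment> \<open>A trapezoid with ramps on \<open>{a..a + d n}\<close> and
      \<open>{b..b + d n}\<close>. Since the ramps start at \<open>a\<close> and \<open>b\<close>,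
      the pointwise limit is the indicator of \<open>{a<..b}\<close>.\<close>
    define \<phi> where "\<phi> n x = smooth_step ((x - a) / d n) - smooth_step ((x - b) / d n)" for n x
    define \<phi>' where "\<phi>' n x = tent ((x - a) / d n) / d n - tent ((x - b) / d n) / d n" for n x
    have deriv: "(\<phi> n has_real_derivative \<phi>' n x) (at x)" for n x
    proof -
      have "((\<lambda>x. smooth_step ((x - s) / d n)) has_real_derivative tent ((x - s) / d n) / d n) (at x)" for s
        using d[of n]
        by (intro DERIV_chain2[where g = "\<lambda>x. (x - s) / d n" and Db = "1 / d n",
              OF smooth_step_deriv, THEN DERIV_cong])
           (auto intro!: derivative_eq_intros)
      then show ?thesis
        unfolding \<phi>_def \<phi>'_def by (intro DERIV_diff)
    qed
    have outside: "\<phi> n x = 0" if "x \<notin> {a..b + d n}" for n x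
    proof (cases "x < a")
      case True
      then show ?thesis
        using d[of n] ab by (auto simp: \<phi>_def smooth_step_eq_0 divide_simps)
    next
      case False
      then have "(x - a) / d n \<ge> 1" "(x - b) / d n \<ge> 1"
        using d[of n] ab that by (auto simp: divide_simps)
      then show ?thesis by (simp add: \<phi>_def smooth_step_eq_1)
    qed
    have test: "test_fun (\<phi> n) (\<phi>' n)" for n
    proof -
      have "closure {t. \<phi> n t \<noteq> 0} \<subseteq> {a..b + d n}"
        using outside by (intro closure_minimal subsetI closed_atLeastAtMost) fastforce
      also have "\<dots> \<subseteq> {0<..<1}" using d[of n] ab by auto
      finally show ?thesis
        using deriv d[of n] unfolding test_fun_def \<phi>'_def
        by (auto intro!: continuous_intros continuous_on_compose2[OF continuous_tent[of UNIV]])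
    qed
    have \<phi>_cont: "continuous_on A (\<phi> n)" for A n
      using deriv DERIV_isCont continuous_at_imp_continuous_on by blast
    have \<phi>_bound: "\<bar>\<phi> n x\<bar> \<le> 1" for n x
      using smooth_step_range[of "(x - a) / d n"] smooth_step_range[of "(x - b) / d n"]
      unfolding \<phi>_def by linarith
    have \<phi>g: "(\<lambda>x. \<phi> n x *\<^sub>R g x) absolutely_integrable_on {0<..<1}" for n
      by (rule absolutely_integrable_continuous_scaleR[OF \<phi>_cont g0])
    have lim1: "(\<lambda>n. integral {0<..<1} (\<lambda>x. \<phi> n x *\<^sub>R g x)) \<longlonglongrightarrow>
        integral {0<..<1} (\<lambda>x. indicator {a<..b} x *\<^sub>R g x)"
    proof (rule dominated_convergence(2))
      show "(\<lambda>x. \<phi> n x *\<^sub>R g x) integrable_on {0<..<1}" for n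
        using \<phi>g absolutely_integrable_on_def by blast
      show "(\<lambda>x. norm (g x)) integrable_on {0<..<1}"
        using g0 absolutely_integrable_on_def by blast
      show "norm (\<phi> n x *\<^sub>R g x) \<le> norm (g x)" for n x
        using \<phi>_bound[of n x] by (simp add: mult_left_le_one_le)
      fix x
      have step: "(\<lambda>n. smooth_step ((x - c) / d n)) \<longlonglongrightarrow> (if x \<le> c then 0 else 1)" for c
      proof (cases "x \<le> c")
        case True
        then have "smooth_step ((x - c) / d n) = 0" for n
          using d[of n] by (intro smooth_step_eq_0) (auto simp: divide_simps)
        then show ?thesis using True by simp
      next
        case False
        then have "\<forall>\<^sub>F n in sequentially. d n < x - c"
          using order_tendstoD(2)[OF dlim, of "x - c"] by simp
        then have "\<forall>\<^sub>F n in sequentially. smooth_step ((x - c) / d n) = 1"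
        proof eventually_elim
          case (elim n)
          then show ?case using d[of n] by (intro smooth_step_eq_1) (auto simp: divide_simps)
        qed
        then show ?thesis using False by (simp add: tendsto_eventually)
      qed
      have "(\<lambda>n. \<phi> n x) \<longlonglongrightarrow> (if x \<le> a then 0 else 1) - (if x \<le> b then 0 else 1)"
        unfolding \<phi>_def by (intro tendsto_diff step)
      also have "(if x \<le> a then 0 else 1) - (if x \<le> b then 0 else (1::real)) = indicator {a<..b} x"
        using ab by (auto simp: indicator_def)
      finally show "(\<lambda>n. \<phi> n x *\<^sub>R g x) \<longlonglongrightarrow> indicator {a<..b} x *\<^sub>R g x"
        by (intro tendsto_scaleR tendsto_const)
    qed
    have eqI: "integral {0<..<1} (\<lambda>x. indicator {a<..b} x *\<^sub>R g x) = integral {a..b} g"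
    proof -
      have "integral {0<..<1} (\<lambda>x. indicator {a<..b} x *\<^sub>R g x) =
          integral {0<..<1} (\<lambda>x. if x \<in> {a<..b} then g x else 0)"
        by (rule arg_cong[where f = "integral _"]) (auto simp: indicator_def)
      also have "\<dots> = integral ({0<..<1} \<inter> {a<..b}) g"
        by (subst integral_restrict_Int) (simp only: Int_commute)
      also have "{0<..<1} \<inter> {a<..b} = {a<..b}" using ab by auto
      also have "integral {a<..b} g = integral {a..b} g"
        by (rule integral_spike_set; rule negligible_subset[of "{a}"]) auto
      finally show ?thesis .
    qed
    \<comment> \<open>The derivative of the trapezoid is a difference of two tents, which average
      \<open>\<gamma>\<close> just to the right of \<open>a\<close> and of \<open>b\<close>.\<close>
    have \<phi>'\<gamma>: "integral {0<..<1} (\<lambda>x. \<phi>' n x *\<^sub>R \<gamma> x) =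
        integral {a..a + d n} (\<lambda>x. (tent ((x - a) / d n) / d n) *\<^sub>R \<gamma> x) -
        integral {b..b + d n} (\<lambda>x. (tent ((x - b) / d n) / d n) *\<^sub>R \<gamma> x)" for n
    proof -
      have tc: "continuous_on {0..1} (\<lambda>x. (tent ((x - c) / d n) / d n) *\<^sub>R \<gamma> x)" for c
        using d[of n] by (intro continuous_intros cont continuous_on_compose2[OF continuous_tent[of UNIV]]) auto
      have sub: "integral {0..1} (\<lambda>x. (tent ((x - c) / d n) / d n) *\<^sub>R \<gamma> x) =
          integral {c..c + d n} (\<lambda>x. (tent ((x - c) / d n) / d n) *\<^sub>R \<gamma> x)"
        if c: "0 \<le> c" "c + d n \<le> 1" for c
      proof -
        have "integral {0..1} (\<lambda>x. (tent ((x - c) / d n) / d n) *\<^sub>R \<gamma> x) =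
            integral {0..1} (\<lambda>x. if x \<in> {c..c + d n} then (tent ((x - c) / d n) / d n) *\<^sub>R \<gamma> x else 0)"
          using d[of n] by (intro Henstock_Kurzweil_Integration.integral_cong) (auto simp: tent_eq_0 divide_simps)
        also have "\<dots> = integral ({c..c + d n} \<inter> {0..1}) (\<lambda>x. (tent ((x - c) / d n) / d n) *\<^sub>R \<gamma> x)"
          by (rule integral_restrict_Int)
        also have "{c..c + d n} \<inter> {0..1} = {c..c + d n}" using c by auto
        finally show ?thesis .
      qed
      have "integral {0<..<1} (\<lambda>x. \<phi>' n x *\<^sub>R \<gamma> x) = integral {0..1} (\<lambda>x. \<phi>' n x *\<^sub>R \<gamma> x)"
        by (rule integral_open_interval_real[symmetric])
      also have "\<dots> = integral {0..1} (\<lambda>x. (tent ((x - a) / d n) / d n) *\<^sub>R \<gamma> x) -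
          integral {0..1} (\<lambda>x. (tent ((x - b) / d n) / d n) *\<^sub>R \<gamma> x)"
        unfolding \<phi>'_def scaleR_diff_left
        by (intro integral_diff integrable_continuous_interval tc)
      finally show ?thesis
        using ab d[of n] by (simp add: sub)
    qed
    have lim2: "(\<lambda>n. integral {c..c + d n} (\<lambda>x. (tent ((x - c) / d n) / d n) *\<^sub>R \<gamma> x)) \<longlonglongrightarrow> \<gamma> c"
      if c: "0 < c" "c \<le> b" for c
    proof (rule tendstoI)
      fix e :: real assume "e > 0"
      moreover have "c \<in> {0..1}" using c ab by auto
      ultimately obtain \<eta> where \<eta>: "\<eta> > 0" "\<And>x. x \<in> {0..1} \<Longrightarrow> dist x c < \<eta> \<Longrightarrow> dist (\<gamma> x) (\<gamma> c) < e / 2"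
        using cont[unfolded continuous_on_iff] by (meson half_gt_zero)
      have "\<forall>\<^sub>F n in sequentially. d n < \<eta>"
        using order_tendstoD(2)[OF dlim \<eta>(1)] .
      then show "\<forall>\<^sub>F n in sequentially.
          dist (integral {c..c + d n} (\<lambda>x. (tent ((x - c) / d n) / d n) *\<^sub>R \<gamma> x)) (\<gamma> c) < e"
      proof eventually_elim
        case (elim n)
        have "norm (integral {c..c + d n} (\<lambda>x. (tent ((x - c) / d n) / d n) *\<^sub>R \<gamma> x) - \<gamma> c) \<le> e / 2"
        proof (rule norm_integral_tent_diff_le)
          show "d n > 0" by (rule d)
          show "continuous_on {c..c + d n} \<gamma>"
            by (rule continuous_on_subset[OF cont]) (use c d[of n] in auto)
          show "norm (\<gamma> x - \<gamma> c) \<le> e / 2" if "x \<in> {c..c + d n}" for x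
            using \<eta>(2)[of x] that c d[of n] elim by (auto simp: dist_norm less_imp_le)
        qed
        then show ?case using \<open>e > 0\<close> by (simp add: dist_norm)
      qed
    qed
    have LINT_eq: "integral {0<..<1} (\<lambda>x. \<phi>' n x *\<^sub>R \<gamma> x) = - integral {0<..<1} (\<lambda>x. \<phi> n x *\<^sub>R g x)" for n
    proof -
      have "continuous_on {0..1} (\<lambda>x. \<phi>' n x *\<^sub>R \<gamma> x)"
        using test[of n] by (intro continuous_intros cont) (auto simp: test_fun_def intro: continuous_on_subset)
      then have "(\<lambda>x. \<phi>' n x *\<^sub>R \<gamma> x) absolutely_integrable_on {0..1}"
        by (rule absolutely_integrable_continuous_real)
      then have "(\<lambda>x. \<phi>' n x *\<^sub>R \<gamma> x) absolutely_integrable_on {0<..<1}"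
        by (rule set_integrable_subset) auto
      then show ?thesis
        using weak[OF test[of n]] \<phi>g[of n] by (simp add: set_lebesgue_integral_eq_integral(2))
    qed
    have "(\<lambda>n. - integral {0<..<1} (\<lambda>x. \<phi> n x *\<^sub>R g x)) \<longlonglongrightarrow> \<gamma> a - \<gamma> b"
      unfolding LINT_eq[symmetric] \<phi>'\<gamma> using ab by (intro tendsto_diff lim2) auto
    moreover have "(\<lambda>n. - integral {0<..<1} (\<lambda>x. \<phi> n x *\<^sub>R g x)) \<longlonglongrightarrow> - integral {a..b} g"
      using tendsto_minus[OF lim1] by (simp only: eqI)
    ultimately have "\<gamma> a - \<gamma> b = - integral {a..b} g"
      by (rule LIMSEQ_unique)
    then show ?thesis by (metis minus_diff_eq neg_equal_iff_equal)
  qed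
  \<comment> \<open>Test functions vanish near 0 and 1, so only interior times have been reached.
    \<open>H\<close> is constant there and continuous up to the end points, which extends the
    formula to \<open>{0..1}\<close>.\<close>
  define H where "H t = \<gamma> t - integral {0..t} g" for t
  have "continuous_on {0..1} H"
    unfolding H_def by (intro continuous_intros cont indefinite_integral_continuous_1 gint) auto
  then have Hcont: "continuous_on (closure {0<..<1}) H" by simp
  have Hin: "\<forall>x\<in>{0<..<1}. H x = H (1/2)"
  proof
    fix x :: real assume x: "x \<in> {0<..<1}"
    have *: "H a = H b" if "0 < a" "a < b" "b < 1" for a b
    proof -
      have "integral {0..b} g = integral {0..a} g + (\<gamma> b - \<gamma> a)"
        using inner[OF that] that gint[of 0 b]
          Henstock_Kurzweil_Integration.integral_combine[of 0 a b g] by simp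
      then show ?thesis by (simp add: H_def)
    qed
    show "H x = H (1/2)"
    proof (cases "x = 1/2")
      case False
      then consider "x < 1/2" | "1/2 < x" by linarith
      then show ?thesis
        using *[of x "1/2"] *[of "1/2" x] x by cases simp_all
    qed (simp only:)
  qed
  have "H x = H (1/2)" if "x \<in> {0..1}" for x
  proof (rule continuous_constant_on_closure[OF Hcont])
    show "H y = H (1/2)" if "y \<in> {0<..<1}" for y
      using Hin that by (rule bspec)
    show "x \<in> closure {0<..<1}" using that by simp
  qed
  from this[of s] this[of t] have "H s = H t"
    using st by (metis atLeastAtMost_iff order_trans)
  then have "\<gamma> t - \<gamma> s = integral {0..t} g - integral {0..s} g"
    unfolding H_def by (metis add_diff_cancel_left diff_add_cancel)
  moreover have "integral {0..s} g + integral {s..t} g = integral {0..t} g"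
    using st by (intro Henstock_Kurzweil_Integration.integral_combine gint) auto
  ultimately have "integral {s..t} g = \<gamma> t - \<gamma> s"
    by (metis add_diff_cancel_left')
  then show ?thesis using gint[of s t] st by (auto simp: has_integral_iff)
qed

section \<open>Calibrations\<close>

text \<open>
  Bolzano's bisection principle reduces the claim to pairs of times one of which is fixed; an
  excursion into an obstacle is split off at its starting point on the frontier.
\<close>

lemma calibration_le_cost:
  fixes \<gamma> g :: "real \<Rightarrow> real \<times> real" and a u :: "real \<times> real \<Rightarrow> real"
  assumes cont: "continuous_on {0..1} \<gamma>"
    and ac: "\<And>s t. 0 \<le> s \<Longrightarrow> s \<le> t \<Longrightarrow> t \<le> 1 \<Longrightarrow> (g has_integral \<gamma> t - \<gamma> s) {s..t}"
    and gint: "(\<lambda>t. norm (g t)) integrable_on {0..1}"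
    and fint: "(\<lambda>t. a (\<gamma> t) * norm (g t)) integrable_on {0..1}"
    and a1: "\<And>z. 1 \<le> a z" and aQ: "\<And>z. z \<in> \<Union>\<Q> \<Longrightarrow> a z = \<beta>" and \<beta>: "0 \<le> \<beta>"
    and openQ: "\<And>Q. Q \<in> \<Q> \<Longrightarrow> open Q"
    and frontQ: "\<And>Q. Q \<in> \<Q> \<Longrightarrow> frontier Q \<inter> \<Union>\<Q> = {}"
    and uQ: "\<And>Q z w. Q \<in> \<Q> \<Longrightarrow> z \<in> closure Q \<Longrightarrow> w \<in> closure Q \<Longrightarrow> \<bar>u z - u w\<bar> \<le> \<beta> * dist z w"
    and uF: "\<And>z. z \<notin> \<Union>\<Q> \<Longrightarrow> \<exists>e>0. \<forall>w. dist w z < e \<and> w \<notin> \<Union>\<Q> \<longrightarrow> \<bar>u w - u z\<bar> \<le> dist w z"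
  shows "\<bar>u (\<gamma> 1) - u (\<gamma> 0)\<bar> \<le> integral {0..1} (\<lambda>t. a (\<gamma> t) * norm (g t))"
proof -
  define f where "f t = a (\<gamma> t) * norm (g t)" for t
  \<comment> \<open>Integration over a closed segment does not depend on the order of the two times,
    so one estimate covers times before and after a fixed one.\<close>
  define c where "c s t = integral (closed_segment s t) f" for s t
  have seg: "closed_segment s t \<subseteq> {0..1}" if "s \<in> {0..1}" "t \<in> {0..1}" for s t :: real
    using that by (auto simp: closed_segment_eq_real_ivl)
  have f_int: "f integrable_on closed_segment s t" if "s \<in> {0..1}" "t \<in> {0..1}" for s t
    using integrable_on_subinterval[OF fint] seg[OF that] 
    by (auto simp: closed_segment_eq_real_ivl f_def[abs_def])
  have ng_int: "(\<lambda>t. norm (g t)) integrable_on closed_segment s t" if "s \<in> {0..1}" "t \<in> {0..1}" for s t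
    using integrable_on_subinterval[OF gint] seg[OF that] 
    by (auto simp: closed_segment_eq_real_ivl)
  have dist_ng: "dist (\<gamma> s) (\<gamma> t) \<le> integral (closed_segment s t) (\<lambda>t. norm (g t))"
    if "s \<in> {0..1}" "t \<in> {0..1}" for s t
  proof -
    have *: "norm (\<gamma> t - \<gamma> s) \<le> integral {s..t} (\<lambda>t. norm (g t))"
      if "s \<in> {0..1}" "t \<in> {0..1}" "s \<le> t" for s t
    proof -
      have "norm (integral {s..t} g) \<le> integral {s..t} (\<lambda>t. norm (g t))"
        using ac[of s t] ng_int[of s t] that
        by (intro integral_norm_bound_integral) (auto simp: closed_segment_eq_real_ivl)
      then show ?thesis using ac[of s t] that by (auto simp: integral_unique)
    qed
    show ?thesis
      using *[of s t] *[of t s] that by (auto simp: closed_segment_eq_real_ivl dist_norm norm_minus_commute)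
  qed
  have dist_c: "dist (\<gamma> s) (\<gamma> t) \<le> c s t" if "s \<in> {0..1}" "t \<in> {0..1}" for s t
  proof -
    have "integral (closed_segment s t) (\<lambda>t. norm (g t)) \<le> c s t"
      unfolding c_def
    proof (rule integral_le[OF ng_int f_int])
      show "norm (g x) \<le> f x" for x
        using mult_right_mono[OF a1[of "\<gamma> x"], of "norm (g x)"] by (simp add: f_def)
    qed (use that in auto)
    then show ?thesis using dist_ng[OF that] by linarith
  qed
  have c_add: "c s t = c s r + c r t" if "s \<in> {0..1}" "t \<in> {0..1}" "r \<in> closed_segment s t" for r s t
  proof (cases "s \<le> t")
    case True
    then show ?thesis
      using that f_int[OF that(1,2)] Henstock_Kurzweil_Integration.integral_combine[of s r t f]
      by (auto simp: c_def closed_segment_eq_real_ivl split: if_splits)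
  next
    case False
    then show ?thesis
      using that f_int[OF that(1,2)] Henstock_Kurzweil_Integration.integral_combine[of t r s f]
      by (auto simp: c_def closed_segment_eq_real_ivl split: if_splits)
  qed
  \<comment> \<open>The point \<open>\<gamma> r\<close> may lie on the frontier, where the
    coefficient need not be \<open>\<beta>\<close>; a single time does not affect the
    integral.\<close>
  have inQ: "\<bar>u (\<gamma> t) - u (\<gamma> r)\<bar> \<le> c r t"
    if r: "r \<in> {0..1}" and t: "t \<in> {0..1}" and Q: "Q \<in> \<Q>"
      and rt: "\<And>x. x \<in> closed_segment r t \<Longrightarrow> x \<noteq> r \<Longrightarrow> \<gamma> x \<in> Q" and rQ: "\<gamma> r \<in> closure Q"
    for r t Q
  proof -
    have tQ: "\<gamma> t \<in> closure Q"
      using rt[of t] rQ closure_subset by (cases "t = r") auto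
    have "\<bar>u (\<gamma> t) - u (\<gamma> r)\<bar> \<le> \<beta> * dist (\<gamma> r) (\<gamma> t)"
      using uQ[OF Q tQ rQ] by (simp add: dist_commute)
    also have "\<dots> \<le> \<beta> * integral (closed_segment r t) (\<lambda>t. norm (g t))"
      using dist_ng[OF r t] \<beta> by (rule mult_left_mono)
    also have "\<dots> = integral (closed_segment r t) (\<lambda>t. \<beta> * norm (g t))"
      by simp
    also have "\<dots> = c r t"
      unfolding c_def
    proof (rule integral_spike[where S = "{r}"])
      show "f x = \<beta> * norm (g x)" if "x \<in> closed_segment r t - {r}" for x
        using aQ[of "\<gamma> x"] rt[of x] Q that by (auto simp: f_def)
    qed auto
    finally show ?thesis .
  qed
  have loc: "\<exists>d>0. \<forall>t\<in>{0..1}. dist t t0 < d \<longrightarrow> \<bar>u (\<gamma> t) - u (\<gamma> t0)\<bar> \<le> c t0 t"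
    if t0: "t0 \<in> {0..1}" for t0
  proof (cases "\<gamma> t0 \<in> \<Union>\<Q>")
    case True
    then obtain Q where Q: "Q \<in> \<Q>" "\<gamma> t0 \<in> Q" by auto
    then obtain e where e: "e > 0" "ball (\<gamma> t0) e \<subseteq> Q"
      using openQ open_contains_ball by blast
    obtain d where d: "d > 0" "\<And>t. t \<in> {0..1} \<Longrightarrow> dist t t0 < d \<Longrightarrow> dist (\<gamma> t) (\<gamma> t0) < e"
      using cont e(1) t0 unfolding continuous_on_iff by meson
    have "\<bar>u (\<gamma> t) - u (\<gamma> t0)\<bar> \<le> c t0 t" if t: "t \<in> {0..1}" "dist t t0 < d" for t
    proof (rule inQ[OF t0 t(1) Q(1)])
      fix x assume x: "x \<in> closed_segment t0 t"
      then have "x \<in> {0..1}" "dist x t0 < d"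
        using seg[OF t0 t(1)] t(2) by (auto simp: closed_segment_eq_real_ivl dist_real_def split: if_splits)
      then have "\<gamma> x \<in> ball (\<gamma> t0) e"
        using d(2)[of x] by (simp add: dist_commute)
      then show "\<gamma> x \<in> Q" using e(2) by auto
    qed (use Q closure_subset in auto)
    then show ?thesis using d(1) by blast
  next
    case False
    obtain e where e: "e > 0" "\<And>w. dist w (\<gamma> t0) < e \<Longrightarrow> w \<notin> \<Union>\<Q> \<Longrightarrow> \<bar>u w - u (\<gamma> t0)\<bar> \<le> dist w (\<gamma> t0)"
      using uF[OF False] by blast
    obtain d where d: "d > 0" "\<And>t. t \<in> {0..1} \<Longrightarrow> dist t t0 < d \<Longrightarrow> dist (\<gamma> t) (\<gamma> t0) < e"
      using cont e(1) t0 unfolding continuous_on_iff by meson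
    have free: "\<bar>u (\<gamma> t) - u (\<gamma> t0)\<bar> \<le> c t0 t"
      if t: "t \<in> {0..1}" "dist t t0 < d" and "\<gamma> t \<notin> \<Union>\<Q>" for t
      using e(2)[OF d(2)[OF t] that(3)] dist_c[OF t0 t(1)] by (simp add: dist_commute)
    have "\<bar>u (\<gamma> t) - u (\<gamma> t0)\<bar> \<le> c t0 t"
      if t: "t \<in> {0..1}" "dist t t0 < d" and tQ: "\<gamma> t \<in> \<Union>\<Q>" for t
    proof -
      obtain Q where Q: "Q \<in> \<Q>" "\<gamma> t \<in> Q" using tQ by auto
      have "closed (closed_segment t0 t \<inter> \<gamma> -` (- Q))"
        using openQ[OF Q(1)] continuous_on_subset[OF cont seg[OF t0 t(1)]]
        by (intro continuous_closed_preimage) auto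
      then have "compact (closed_segment t0 t \<inter> \<gamma> -` (- Q))"
        by (metis bounded_subset bounded_closed_segment compact_eq_bounded_closed inf_le1)
      moreover have "t0 \<in> closed_segment t0 t \<inter> \<gamma> -` (- Q)"
        using False Q(1) by auto
      \<comment> \<open>Among the times outside \<open>Q\<close>, \<open>r\<close> is the one
        closest to \<open>t\<close>: the path stays in \<open>Q\<close> from \<open>r\<close> to
        \<open>t\<close>, and \<open>\<gamma> r\<close> is on the frontier.\<close>
      ultimately obtain r where r: "r \<in> closed_segment t0 t" "\<gamma> r \<notin> Q"
        and rmin: "\<And>x. x \<in> closed_segment t0 t \<Longrightarrow> \<gamma> x \<notin> Q \<Longrightarrow> dist r t \<le> dist x t"
        using continuous_attains_inf[of "closed_segment t0 t \<inter> \<gamma> -` (- Q)" "\<lambda>x. dist x t",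
            OF _ _ continuous_on_dist[OF continuous_on_id continuous_on_const]]
        by auto
      have r01: "r \<in> {0..1}" using seg[OF t0 t(1)] r(1) by auto
      have "r \<noteq> t" using r(2) Q(2) by auto
      have rt: "\<gamma> x \<in> Q" if "x \<in> closed_segment r t" "x \<noteq> r" for x
      proof -
        have "x \<in> closed_segment t0 t" "dist x t < dist r t"
          using that r(1) by (auto simp: closed_segment_eq_real_ivl dist_real_def split: if_splits)
        then show ?thesis using rmin[of x] by auto
      qed
      have "\<gamma> ` closure (open_segment r t) \<subseteq> closure Q"
      proof (rule image_closure_subset)
        show "continuous_on (closure (open_segment r t)) \<gamma>"
          using \<open>r \<noteq> t\<close> continuous_on_subset[OF cont seg[OF r01 t(1)]] by simp
        show "\<gamma> ` open_segment r t \<subseteq> closure Q"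
          using rt closure_subset by (fastforce simp: open_segment_def)
      qed auto
      then have rQ: "\<gamma> r \<in> closure Q" using \<open>r \<noteq> t\<close> by auto
      then have "\<gamma> r \<in> frontier Q"
        using r(2) openQ[OF Q(1)] by (simp add: frontier_def interior_open)
      then have "\<gamma> r \<notin> \<Union>\<Q>" using frontQ[OF Q(1)] by auto
      moreover have "dist r t0 < d"
        using r(1) t(2) by (auto simp: closed_segment_eq_real_ivl dist_real_def split: if_splits)
      ultimately have "\<bar>u (\<gamma> r) - u (\<gamma> t0)\<bar> \<le> c t0 r"
        using free r01 by blast
      moreover have "\<bar>u (\<gamma> t) - u (\<gamma> r)\<bar> \<le> c r t"
        using inQ[OF r01 t(1) Q(1) rt rQ] by blast
      ultimately show ?thesis
        using c_add[OF t0 t(1) r(1)] by linarith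
    qed
    then show ?thesis using d(1) free by blast
  qed
  have c_commute: "c s t = c t s" for s t
    by (simp add: c_def closed_segment_commute)
  have "0 \<le> (0::real) \<and> (1::real) \<le> 1 \<longrightarrow> \<bar>u (\<gamma> 1) - u (\<gamma> 0)\<bar> \<le> c 0 1"
  \<comment> \<open>Bisection also looks at intervals that leave \<open>{0..1}\<close>; the premise
    inside \<open>P\<close> makes the claim vacuous there.\<close>
  proof (rule Bolzano[where P = "\<lambda>s t. 0 \<le> s \<and> t \<le> 1 \<longrightarrow> \<bar>u (\<gamma> t) - u (\<gamma> s)\<bar> \<le> c s t"])
    fix r s t :: real
    assume "0 \<le> r \<and> s \<le> 1 \<longrightarrow> \<bar>u (\<gamma> s) - u (\<gamma> r)\<bar> \<le> c r s" "0 \<le> s \<and> t \<le> 1 \<longrightarrow> \<bar>u (\<gamma> t) - u (\<gamma> s)\<bar> \<le> c s t"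
      and "r \<le> s" "s \<le> t"
    then show "0 \<le> r \<and> t \<le> 1 \<longrightarrow> \<bar>u (\<gamma> t) - u (\<gamma> r)\<bar> \<le> c r t"
      using c_add[of r t s] by (auto simp: closed_segment_eq_real_ivl)
  next
    fix x :: real assume "0 \<le> x" "x \<le> 1"
    then obtain d where d: "d > 0" "\<And>t. t \<in> {0..1} \<Longrightarrow> dist t x < d \<Longrightarrow> \<bar>u (\<gamma> t) - u (\<gamma> x)\<bar> \<le> c x t"
      using loc[of x] by auto
    have "\<bar>u (\<gamma> t) - u (\<gamma> s)\<bar> \<le> c s t" if "s \<le> x" "x \<le> t" "t - s < d" "0 \<le> s" "t \<le> 1" for s t
      using d(2)[of s] d(2)[of t] that c_add[of s t x] c_commute[of x s]
      by (auto simp: closed_segment_eq_real_ivl dist_real_def)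
    then show "\<exists>d>0. \<forall>a b. a \<le> x \<and> x \<le> b \<and> b - a < d \<longrightarrow>
        0 \<le> a \<and> b \<le> 1 \<longrightarrow> \<bar>u (\<gamma> b) - u (\<gamma> a)\<bar> \<le> c a b"
      using d(1) by blast
  qed auto
  then show ?thesis
    by (simp add: c_def f_def[abs_def] closed_segment_eq_real_ivl)
qed

text \<open>McShane's formula. Values are indexed rather than attached to points, so that gates can
  be given by their parameters; consistency at a common point is the case of distance 0 in the
  Lipschitz hypothesis.\<close>

lemma lipschitz_extension:
  fixes v :: "'i \<Rightarrow> real" and P :: "'i \<Rightarrow> 'a::metric_space"
  assumes "I \<noteq> {}" and lip: "\<And>i j. i \<in> I \<Longrightarrow> j \<in> I \<Longrightarrow> \<bar>v i - v j\<bar> \<le> K * dist (P i) (P j)"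
    and "0 \<le> K"
  obtains u :: "'a \<Rightarrow> real" where "\<And>i. i \<in> I \<Longrightarrow> u (P i) = v i"
    and "\<And>z w. \<bar>u z - u w\<bar> \<le> K * dist z w"
proof -
  define u where "u z = (INF i\<in>I. v i + K * dist z (P i))" for z
  have tri: "K * dist z w \<le> K * dist z y + K * dist y w" for z w y :: 'a
    using mult_left_mono[OF dist_triangle[of z w y] \<open>0 \<le> K\<close>] by (simp add: distrib_left)
  have bdd: "bdd_below ((\<lambda>i. v i + K * dist z (P i)) ` I)" for z
  proof -
    obtain j where j: "j \<in> I" using \<open>I \<noteq> {}\<close> by auto
    have "v j - K * dist z (P j) \<le> v i + K * dist z (P i)" if "i \<in> I" for i
      using lip[OF j that] tri[of "P j" "P i" z] by (simp add: dist_commute)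
    then show ?thesis by (meson bdd_belowI2)
  qed
  have u_le: "u z \<le> v i + K * dist z (P i)" if "i \<in> I" for i z
    unfolding u_def by (rule cINF_lower[OF bdd that])
  have u_ge: "m \<le> u z" if "\<And>i. i \<in> I \<Longrightarrow> m \<le> v i + K * dist z (P i)" for m z
    unfolding u_def by (rule cINF_greatest[OF \<open>I \<noteq> {}\<close> that])
  have one: "u z - K * dist z w \<le> u w" for z w
  proof (rule u_ge)
    fix i assume "i \<in> I"
    then show "u z - K * dist z w \<le> v i + K * dist w (P i)"
      using u_le[of i z] tri[of z "P i" w] by simp
  qed
  show ?thesis
  proof (rule that)
    fix i assume i: "i \<in> I"
    show "u (P i) = v i"
    proof (rule antisym)
      show "u (P i) \<le> v i" using u_le[OF i, of "P i"] by simp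
      show "v i \<le> u (P i)"
        by (rule u_ge) (use lip[OF i] in \<open>fastforce simp: abs_le_iff\<close>)
    qed
  next
    show "\<bar>u z - u w\<bar> \<le> K * dist z w" for z w
      using one[of z w] one[of w z] by (simp add: dist_commute abs_le_iff)
  qed
qed

section \<open>Inequalities between gates\<close>

text \<open>Cauchy-Schwarz for \<open>(a, d)\<close> and \<open>(b, d)\<close>, with the defect
  \<open>d\<^sup>2 * (a - b)\<^sup>2\<close>.\<close>

lemma sqrt_add_square_mult_ge: "a * b + d\<^sup>2 \<le> sqrt (a\<^sup>2 + d\<^sup>2) * sqrt (b\<^sup>2 + d\<^sup>2)"
proof -
  have "(a * b + d\<^sup>2)\<^sup>2 + d\<^sup>2 * (a - b)\<^sup>2 = (a\<^sup>2 + d\<^sup>2) * (b\<^sup>2 + d\<^sup>2)"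
    by (simp add: power2_eq_square algebra_simps)
  then have "(a * b + d\<^sup>2)\<^sup>2 \<le> (a\<^sup>2 + d\<^sup>2) * (b\<^sup>2 + d\<^sup>2)"
    by (metis le_add_same_cancel1 zero_le_mult_iff zero_le_power2)
  then show ?thesis
    by (metis real_le_rsqrt real_sqrt_mult)
qed

text \<open>The length of a segment with displacement \<open>x\<close> along a channel and
  \<open>d\<close> across it. With \<open>d\<close> fixed it is a convex function of
  \<open>x\<close>, from which most estimates between gates follow.\<close>

definition hyp :: "real \<Rightarrow> real \<Rightarrow> real" where
  "hyp d x = sqrt (x\<^sup>2 + d\<^sup>2)"

lemma hyp_minus: "hyp d (- x) = hyp d x"
  by (simp add: hyp_def)

lemma hyp_ge: "\<bar>x\<bar> \<le> hyp d x" "\<bar>d\<bar> \<le> hyp d x" "0 \<le> hyp d x"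
  by (auto simp: hyp_def real_le_rsqrt)

lemma hyp_square: "(hyp d x)\<^sup>2 = x\<^sup>2 + d\<^sup>2"
  by (simp add: hyp_def)

lemma hyp_lipschitz: "\<bar>hyp d x - hyp d y\<bar> \<le> \<bar>x - y\<bar>"
proof -
  have "hyp d x = norm (x, d)" for x by (simp add: hyp_def norm_Pair)
  then show ?thesis
    using norm_triangle_ineq3[of "(x, d)" "(y, d)"] by simp
qed

lemma hyp_mono: "0 \<le> x \<Longrightarrow> x \<le> y \<Longrightarrow> hyp d x \<le> hyp d y"
  by (simp add: hyp_def power_mono)

lemma hyp_deriv:
  assumes "d \<noteq> 0" shows "(hyp d has_real_derivative x / hyp d x) (at x)"
proof -
  have "x\<^sup>2 + d\<^sup>2 > 0" using assms by (simp add: add_nonneg_pos)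
  then show ?thesis
    unfolding hyp_def by (auto intro!: derivative_eq_intros simp: divide_simps)
qed

lemma slope_strict_mono:
  assumes "d \<noteq> 0" "x < y" shows "x / hyp d x < y / hyp d y"
proof -
  have pos: "hyp d z > 0" for z using hyp_ge(2)[of d z] assms(1) by linarith
  have "((\<lambda>x. x / hyp d x) has_real_derivative
      (1 * hyp d z - z * (z / hyp d z)) / (hyp d z * hyp d z)) (at z)" for z
    using pos[of z] by (intro DERIV_divide hyp_deriv[OF assms(1)] DERIV_ident) simp
  moreover have "0 < (1 * hyp d z - z * (z / hyp d z)) / (hyp d z * hyp d z)" for z
  proof -
    have dd: "0 < d * d" using assms(1) by (metis not_real_square_gt_zero)
    have "z * z < hyp d z * hyp d z"
      using hyp_square[of d z] by (simp add: power2_eq_square dd)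
    then have "z * (z / hyp d z) < hyp d z" using pos[of z] by (simp add: divide_simps)
    then show ?thesis using pos[of z] by simp
  qed
  ultimately show ?thesis
    using DERIV_pos_imp_increasing[OF assms(2)] by blast
qed

text \<open>The slope of \<open>hyp d\<close> increases strictly, so the increment over a fixed
  length \<open>t\<close> has a positive derivative.\<close>

lemma hyp_increment_strict_mono:
  assumes "d \<noteq> 0" "x < y" "0 < t"
  shows "hyp d (x + t) - hyp d x < hyp d (y + t) - hyp d y"
proof -
  let ?f = "\<lambda>z. hyp d (z + t) - hyp d z"
  have "((\<lambda>z. hyp d (z + t)) has_real_derivative (z + t) / hyp d (z + t)) (at z)" for z
    by (rule DERIV_chain2[where g = "\<lambda>z. z + t" and Db = 1, OF hyp_deriv, THEN DERIV_cong])
       (auto intro!: derivative_eq_intros assms)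
  then have "(?f has_real_derivative (z + t) / hyp d (z + t) - z / hyp d z) (at z)" for z
    by (intro DERIV_diff hyp_deriv assms)
  then show ?thesis
    using slope_strict_mono[OF assms(1)] assms(3)
    by (intro DERIV_pos_imp_increasing[OF assms(2), of ?f]) (auto intro!: exI)
qed

lemma hyp_increment_mono:
  assumes "d \<noteq> 0" "x \<le> y" "0 \<le> t"
  shows "hyp d (x + t) - hyp d x \<le> hyp d (y + t) - hyp d y"
  using hyp_increment_strict_mono[of d x y t] assms by (cases "x = y \<or> t = 0") auto

text \<open>The tangent line at \<open>x\<close> lies below the graph; multiplication by
  \<open>hyp d x\<close> clears the denominator of its slope.\<close>

lemma hyp_tangent:
  assumes "d \<noteq> 0" shows "hyp d x * (hyp d (x + t) - hyp d x) \<ge> x * t"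
proof -
  have "x * (x + t) + d\<^sup>2 \<le> hyp d x * hyp d (x + t)"
    using sqrt_add_square_mult_ge[of x "x + t" d] by (simp add: hyp_def)
  then show ?thesis using hyp_square[of d x] by (simp add: power2_eq_square algebra_simps)
qed

text \<open>By convexity the first of \<open>n\<close> unit increments is the smallest. The next
  lemma treats moves to the left, where the increment next to the starting point is the
  largest.\<close>

lemma hyp_add_nat_ge:
  assumes "d \<noteq> 0"
  shows "real n * (hyp d (x + 1) - hyp d x) \<le> hyp d (x + real n) - hyp d x"
proof (induction n)
  case (Suc n)
  have "hyp d (x + 1) - hyp d x \<le> hyp d (x + real n + 1) - hyp d (x + real n)"
    by (rule hyp_increment_mono) (use assms in auto)
  with Suc show ?case by (simp add: algebra_simps)
qed auto

lemma hyp_sub_nat_le: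
  assumes "d \<noteq> 0"
  shows "hyp d (x + 1) - hyp d (x + 1 - real n) \<le> real n * (hyp d (x + 1) - hyp d x)"
proof (induction n)
  case (Suc n)
  have "hyp d (x - real n + 1) - hyp d (x - real n) \<le> hyp d (x + 1) - hyp d x"
    by (rule hyp_increment_mono) (use assms in auto)
  with Suc show ?case by (simp add: algebra_simps)
qed auto

section \<open>Constants of the calibration and the estimates for its gate values\<close>

locale obstacles =
  fixes \<rho> \<beta> :: real
  assumes rho: "1 / 2 < \<rho>" "\<rho> < 1" and beta: "2 < \<beta>"
begin

abbreviation gap :: real where "gap \<equiv> 1 - \<rho>"

abbreviation f :: "real \<Rightarrow> real" where "f \<equiv> hyp gap"

text \<open>
  \<open>c k\<close> will be the value of the limit metric at \<open>(k + 1, 1)\<close>: one crosses a horizontal channel from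
  corner to corner over \<open>k\<close> full obstacles, and then a vertical one, at cost \<open>L\<close>. The vector
  \<open>(p k, q k)\<close> is the gradient on the cone spanned by \<open>(k + 1, 1)\<close> and \<open>(k + 2, 1)\<close>.
\<close>

definition L :: real where "L = f \<rho>"

definition c :: "nat \<Rightarrow> real" where "c k = f (real k + \<rho>) + L"

definition p :: "nat \<Rightarrow> real" where "p k = f (real k + \<rho> + 1) - f (real k + \<rho>)"

definition q :: "nat \<Rightarrow> real" where "q k = c k - (real k + 1) * p k"

text \<open>
  The profile of the calibration along a gate. With a constant profile it could fail to be
  1-Lipschitz along the channel, with slope \<open>p k\<close> it would fail to be so across the channel.
\<close>

definition h :: "nat \<Rightarrow> real \<Rightarrow> real" where
  "h k t = f (real k + \<rho> + t) - f (real k + \<rho>)"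

lemma p_eq: "p k = c (Suc k) - c k"
  by (simp add: p_def c_def add.commute add.left_commute)

lemma gap_nz: "gap \<noteq> 0" using rho by simp

lemma p_bounds: "0 \<le> p k" "p k \<le> 1"
  using hyp_lipschitz[of gap "real k + \<rho> + 1" "real k + \<rho>"] rho
    hyp_mono[of "real k + \<rho>" "real k + \<rho> + 1" gap]
  by (auto simp: p_def)

lemma p_strict_mono: "p k < p (Suc k)"
  using hyp_increment_strict_mono[OF gap_nz, of "real k + \<rho>" "real (Suc k) + \<rho>" 1]
  by (simp add: p_def add_ac)

lemma h_bounds: "0 \<le> t \<Longrightarrow> 0 \<le> h k t" "0 \<le> t \<Longrightarrow> h k t \<le> t"
  using hyp_lipschitz[of gap "real k + \<rho> + t" "real k + \<rho>"] rho
    hyp_mono[of "real k + \<rho>" "real k + \<rho> + t" gap]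
  by (auto simp: h_def)

lemma h_le_p: "0 \<le> t \<Longrightarrow> t \<le> 1 \<Longrightarrow> h k t \<le> p k"
  using hyp_mono[of "real k + \<rho> + t" "real k + \<rho> + 1" gap] rho
  by (auto simp: h_def p_def)

lemma h_lipschitz: "\<bar>h k s - h k t\<bar> \<le> \<bar>s - t\<bar>"
  using hyp_lipschitz[of gap "real k + \<rho> + s" "real k + \<rho> + t"] by (simp add: h_def)

lemma h_superadditive:
  assumes "0 \<le> s" "0 \<le> t" shows "h k s + h k t \<le> h k (s + t)"
  using hyp_increment_mono[OF gap_nz, of "real k + \<rho>" "real k + \<rho> + s" t] assms
  by (simp add: h_def add_ac)

lemma h_tangent: "(real k + \<rho>) * t \<le> f (real k + \<rho>) * h k t"
  using hyp_tangent[OF gap_nz, of "real k + \<rho>" t] by (simp add: h_def)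

text \<open>For \<open>n > 0\<close> one of the \<open>n\<close> periods is compared with the
  profile, through \<open>0 \<le> p k - h k t \<le> 1 - t\<close>; the others only use
  \<open>0 \<le> p k \<le> 1\<close>.\<close>

lemma gate_same_nat:
  fixes n :: nat
  assumes "0 \<le> s" "s \<le> gap" "0 \<le> t" "t \<le> gap"
  shows "\<bar>real n * p k + h k s - h k t\<bar> \<le> \<bar>real n + s - t\<bar>"
proof (cases n)
  case 0
  then show ?thesis using h_lipschitz[of k s t] by simp
next
  case (Suc m)
  have "real m * p k \<le> real m" using p_bounds[of k] by (simp add: mult_left_le)
  moreover have "p k - h k t \<le> 1 - t"
    using hyp_lipschitz[of gap "real k + \<rho> + 1" "real k + \<rho> + t"] assms rho
    by (auto simp: p_def h_def)
  moreover have "0 \<le> real m * p k" "h k t \<le> p k" "0 \<le> h k s" "h k s \<le> s"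
    using h_bounds[of s k] h_le_p[of t k] assms rho p_bounds[of k] by auto
  moreover have "real n * p k = real m * p k + p k" using Suc by (simp add: algebra_simps)
  ultimately show ?thesis using assms rho Suc by (simp add: abs_le_iff)
qed

lemma gate_same:
  fixes n :: int
  assumes "0 \<le> s" "s \<le> gap" "0 \<le> t" "t \<le> gap"
  shows "\<bar>real_of_int n * p k + h k s - h k t\<bar> \<le> \<bar>real_of_int n + s - t\<bar>"
proof (cases "n \<ge> 0")
  case True
  then show ?thesis using gate_same_nat[OF assms, of "nat n" k] by simp
next
  case False
  then have "real (nat (- n)) = - real_of_int n" by simp
  then have "\<bar>- (real_of_int n * p k) + h k t - h k s\<bar> \<le> \<bar>- real_of_int n + t - s\<bar>"
    using gate_same_nat[OF assms(3,4,1,2), of "nat (-n)" k] by simp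
  then show ?thesis by linarith
qed

lemma L_square: "L\<^sup>2 = \<rho>\<^sup>2 + gap\<^sup>2"
  by (simp add: L_def hyp_square)

text \<open>The last bound is used as \<open>2 * gap \<le> 3 / 2 * L\<close>, where
  \<open>2 * gap\<close> is the largest total offset of two gate points. It follows from
  \<open>gap \<le> \<rho>\<close>.\<close>

lemma L_bounds: "\<rho> \<le> L" "gap < L" "L \<le> 1" "4 * gap \<le> 3 * L"
proof -
  show 1: "\<rho> \<le> L" "gap < L" using hyp_ge[of \<rho> gap] rho by (auto simp: L_def)
  have "L\<^sup>2 \<le> 1\<^sup>2"
    unfolding L_square using rho mult_nonneg_nonneg[of \<rho> gap]
    by (simp add: power2_eq_square algebra_simps)
  then show "L \<le> 1" by (rule power2_le_imp_le) simp
  have "gap\<^sup>2 \<le> \<rho>\<^sup>2" using rho by (intro power_mono) auto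
  moreover have "16 * a \<le> 9 * b + 9 * a" if "a \<le> b" "0 \<le> b" for a b :: real
    using that by linarith
  ultimately have "16 * gap\<^sup>2 \<le> 9 * \<rho>\<^sup>2 + 9 * gap\<^sup>2"
    by (meson zero_le_power2)
  moreover have "(4 * gap)\<^sup>2 = 16 * gap\<^sup>2" "(3 * L)\<^sup>2 = 9 * L\<^sup>2"
    by (simp_all add: power2_eq_square algebra_simps)
  ultimately have "(4 * gap)\<^sup>2 \<le> (3 * L)\<^sup>2" by (simp only: L_square distrib_left)
  then show "4 * gap \<le> 3 * L" by (rule power2_le_imp_le) (use 1 rho in auto)
qed

text \<open>A quantitative form of \<open>p 0 < 1\<close>, needed for the reverse crossings in
  \<open>gate_strip_lower\<close>. After squaring, the difference of the two sides factors into
  nonnegative terms.\<close>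

lemma p0_le: "p 0 \<le> 1 - (L - \<rho>) / 2"
proof -
  have "f (\<rho> + 1) \<le> 1 + \<rho> + (L - \<rho>) / 2"
  proof (rule power2_le_imp_le)
    have "0 \<le> (L - \<rho>) * (1 - L + (L - \<rho>) / 4)"
      using L_bounds by (intro mult_nonneg_nonneg) auto
    then show "(f (\<rho> + 1))\<^sup>2 \<le> (1 + \<rho> + (L - \<rho>) / 2)\<^sup>2"
      using L_square unfolding hyp_square by (simp add: power2_eq_square field_simps)
    show "0 \<le> 1 + \<rho> + (L - \<rho>) / 2" using L_bounds rho by simp
  qed
  then show ?thesis by (simp add: p_def L_def field_simps)
qed

text \<open>The chord of \<open>f\<close> between the two optimal displacements
  \<open>k + \<rho>\<close> and \<open>k + \<rho> + 1\<close> has slope \<open>p k\<close>, and at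
  both of them the bound is attained. From a displacement in between, convexity makes unit
  increments to the right at least \<open>p k\<close> and those to the left at most
  \<open>p k\<close>. The offset \<open>s + t\<close> stays below 1 because the gates are
  narrow.\<close>

lemma gate_strip_upper:
  fixes m :: int
  assumes "0 \<le> s" "s \<le> gap" "0 \<le> t" "t \<le> gap"
  shows "real_of_int m * p k + f (real k + \<rho>) + h k s + h k t \<le> f (real k + \<rho> + (s + t) + m)"
proof -
  let ?\<kappa> = "real k + \<rho>" and ?r = "s + t"
  have r: "0 \<le> ?r" "?r \<le> 1" using assms rho by auto
  have "real_of_int m * p k + f (?\<kappa> + ?r) \<le> f (?\<kappa> + ?r + m)"
  proof (cases "m \<ge> 0")
    case True
    then obtain n where m: "m = int n" using nonneg_int_cases by blast
    have "p k \<le> f (?\<kappa> + ?r + 1) - f (?\<kappa> + ?r)"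
      unfolding p_def by (rule hyp_increment_mono) (use gap_nz r in auto)
    then have "real n * p k \<le> real n * (f (?\<kappa> + ?r + 1) - f (?\<kappa> + ?r))"
      by (intro mult_left_mono) auto
    also have "\<dots> \<le> f (?\<kappa> + ?r + real n) - f (?\<kappa> + ?r)"
      by (rule hyp_add_nat_ge[OF gap_nz])
    finally show ?thesis using m by simp
  next
    case False
    define n where "n = nat (- m)"
    have m: "m = - int n" using False by (simp add: n_def)
    have "f (?\<kappa> + ?r - 1 + 1) - f (?\<kappa> + ?r - 1) \<le> p k"
      unfolding p_def by (rule hyp_increment_mono) (use gap_nz r in auto)
    then have "real n * (f (?\<kappa> + ?r - 1 + 1) - f (?\<kappa> + ?r - 1)) \<le> real n * p k"
      by (intro mult_left_mono) auto
    moreover have "f (?\<kappa> + ?r - 1 + 1) - f (?\<kappa> + ?r - 1 + 1 - real n)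
        \<le> real n * (f (?\<kappa> + ?r - 1 + 1) - f (?\<kappa> + ?r - 1))"
      by (rule hyp_sub_nat_le[OF gap_nz])
    ultimately show ?thesis using m by (simp add: algebra_simps)
  qed
  moreover have "h k s + h k t \<le> f (?\<kappa> + ?r) - f ?\<kappa>"
    using h_superadditive[of s t k] assms by (simp add: h_def)
  ultimately show ?thesis by linarith
qed

text \<open>Only \<open>m < 0\<close> is critical, a crossing that runs against the optimal path.
  There \<open>f\<close> may be replaced by the absolute value of its argument, which reduces the
  claim to a comparison of \<open>n * p k\<close> with \<open>n\<close>.\<close>

lemma gate_strip_lower:
  fixes m :: int
  assumes "0 \<le> s" "s \<le> gap" "0 \<le> t" "t \<le> gap"
  shows "- (real_of_int m * p k + f (real k + \<rho>) + h k s + h k t) \<le> f (real k + \<rho> + (s + t) + m)"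
proof -
  let ?\<kappa> = "real k + \<rho>" and ?r = "s + t" and ?S = "f (real k + \<rho>)" and ?w = "h k s + h k t"
  have r: "0 \<le> ?r" "?r \<le> 2 * gap" using assms by auto
  have S: "?\<kappa> \<le> ?S" "0 < ?S" using hyp_ge(1)[of ?\<kappa> gap] rho by auto
  have w: "0 \<le> ?w" "?\<kappa> * ?r \<le> ?S * ?w"
    using h_bounds[of s k] h_bounds[of t k] h_tangent[of k s] h_tangent[of k t] assms
    by (auto simp: distrib_left)
  show ?thesis
  proof (cases "m \<ge> 0")
    case True
    then have "0 \<le> real_of_int m * p k" using p_bounds[of k] by simp
    then show ?thesis using S w hyp_ge(3)[of gap "?\<kappa> + ?r + m"] by linarith
  next
    case False
    define n where "n = - real_of_int m"
    have n: "n \<ge> 1" using False by (simp add: n_def)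
    have far: "n - ?\<kappa> - ?r \<le> f (?\<kappa> + ?r + m)"
      using hyp_ge(1)[of "?\<kappa> + ?r + m" gap] by (simp add: n_def)
    have "n * p k \<le> ?S + ?w + (n - ?\<kappa> - ?r)"
    proof (cases "?r \<le> ?S")
      case True
      \<comment> \<open>When this product is expanded, the tangent bound for \<open>?w\<close> turns
        it into \<open>?S\<close> times the wanted slack.\<close>
      have "0 \<le> (?S - ?\<kappa>) * (?S - ?r)" using S True by (intro mult_nonneg_nonneg) auto
      also have "\<dots> \<le> ?S * (?S + ?w - ?\<kappa> - ?r)" using w by (simp add: algebra_simps)
      finally have "0 \<le> ?S + ?w - ?\<kappa> - ?r" using S by (simp add: zero_le_mult_iff)
      moreover have "n * p k \<le> n" using p_bounds[of k] n by (simp add: mult_left_le)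
      ultimately show ?thesis by linarith
    next
      case False
      \<comment> \<open>For \<open>k > 0\<close> the value \<open>?S\<close> exceeds 1, while
        \<open>?r\<close> does not. For \<open>k = 0\<close> the slack may be negative, but by at
        most \<open>(L - \<rho>) / 2\<close>, which is the margin provided by
        \<open>p0_le\<close>.\<close>
      then have "k = 0" using S(1) r rho by (cases k) auto
      then have SL: "?S = L" and \<kappa>: "?\<kappa> = \<rho>" by (auto simp: L_def)
      have "n * p k \<le> n * (1 - (L - \<rho>) / 2)"
        using p0_le \<open>k = 0\<close> n by (intro mult_left_mono) auto
      also have "\<dots> = n - n * ((L - \<rho>) / 2)" by (simp add: algebra_simps)
      also have "\<dots> \<le> n - 1 * ((L - \<rho>) / 2)"
        using n L_bounds by (intro diff_left_mono mult_right_mono) auto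
      finally have 1: "n * p k \<le> n - (L - \<rho>) / 2" by simp
      have "0 \<le> (L - \<rho>) * (3 / 2 * L - ?r)"
        using L_bounds r by (intro mult_nonneg_nonneg) auto
      also have "\<dots> \<le> L * (3 / 2 * (L - \<rho>) + ?w - ?r)"
        using w(2) unfolding \<kappa> L_def[symmetric] by (simp add: algebra_simps)
      finally have "0 \<le> 3 / 2 * (L - \<rho>) + ?w - ?r"
        using S(2) SL by (simp add: zero_le_mult_iff)
      then show ?thesis using 1 unfolding \<kappa> L_def[symmetric] by argo
    qed
    then show ?thesis using far by (simp add: n_def)
  qed
qed

text \<open>Cauchy-Schwarz against the optimal displacement \<open>(gap, \<rho>)\<close>, whose
  length is \<open>L\<close>, leaves the requirement that the profile rises at least at rate
  \<open>gap / L\<close>. The tangent bound provides \<open>\<rho> / L\<close>, which is at least as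
  large.\<close>

lemma gate_block:
  assumes "0 \<le> s" "s \<le> gap" "0 \<le> t" "t \<le> gap"
  shows "\<bar>L - h k s - h k t\<bar> \<le> hyp \<rho> (gap - s - t)"
proof -
  have h_ge: "gap * x \<le> L * h k x" if "0 \<le> x" for x
  proof -
    have "gap * x \<le> \<rho> * x" using rho that by (intro mult_right_mono) auto
    also have "\<dots> \<le> L * h 0 x" using h_tangent[of 0 x] by (simp add: L_def)
    also have "\<dots> \<le> L * h k x"
      using hyp_increment_mono[OF gap_nz, of \<rho> "real k + \<rho>" x] that L_bounds rho
      by (intro mult_left_mono) (auto simp: h_def)
    finally show ?thesis .
  qed
  have "gap * (gap - s - t) + \<rho>\<^sup>2 \<le> L * hyp \<rho> (gap - s - t)"
    using sqrt_add_square_mult_ge[of gap "gap - s - t" \<rho>]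
    by (simp add: L_def hyp_def add.commute)
  then have "L * (L - h k s - h k t) \<le> L * hyp \<rho> (gap - s - t)"
    using h_ge[OF assms(1)] h_ge[OF assms(3)] L_square by (simp add: power2_eq_square algebra_simps)
  then have "L - h k s - h k t \<le> hyp \<rho> (gap - s - t)"
    using L_bounds rho by simp
  moreover have "h k s + h k t - L \<le> \<rho>"
    using h_bounds[of s k] h_bounds[of t k] assms L_bounds rho by linarith
  ultimately show ?thesis
    using hyp_ge(2)[of \<rho> "gap - s - t"] rho by (simp add: abs_le_iff)
qed

text \<open>Reflection in the diagonal exchanges the components of the gradient
  \<open>(p 0, q 0)\<close>, so this inequality is the kink there. It amounts to
  \<open>2 * L < f (\<rho> + 1)\<close>.\<close>

lemma q0_less_p0: "q 0 < p 0"
proof -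
  have "2 * L < f (\<rho> + 1)"
  proof (rule power2_less_imp_less)
    have "0 < (3 * \<rho> - 1) * (1 - \<rho>)" using rho by simp
    then show "(2 * L)\<^sup>2 < (f (\<rho> + 1))\<^sup>2"
      unfolding power_mult_distrib L_square hyp_square by (simp add: power2_eq_square algebra_simps)
  qed (rule hyp_ge)
  then show ?thesis by (simp add: q_def p_def c_def L_def)
qed

end

lemma dist_prod_bounds:
  fixes z w :: "real \<times> real"
  shows "\<bar>fst z - fst w\<bar> \<le> dist z w" "\<bar>snd z - snd w\<bar> \<le> dist z w"
    "dist z w \<le> \<bar>fst z - fst w\<bar> + \<bar>snd z - snd w\<bar>"
proof -
  show "\<bar>fst z - fst w\<bar> \<le> dist z w" "\<bar>snd z - snd w\<bar> \<le> dist z w"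
    using dist_fst_le[of z w] dist_snd_le[of z w] by (simp_all add: dist_real_def)
  show "dist z w \<le> \<bar>fst z - fst w\<bar> + \<bar>snd z - snd w\<bar>"
    unfolding dist_prod_def dist_real_def
    using sqrt_sum_squares_le_sum_abs[of "\<bar>fst z - fst w\<bar>" "\<bar>snd z - snd w\<bar>"] by simp
qed

lemma dist_eq_hyp: "dist (x, y) (x', y') = hyp (y - y') (x - x')" for x y x' y' :: real
  by (simp add: dist_Pair_Pair dist_real_def hyp_def)

lemma hyp_0: "hyp 0 x = \<bar>x\<bar>"
  by (simp add: hyp_def)

lemma hyp_minus_left: "hyp (- d) x = hyp d x"
  by (simp add: hyp_def)

text \<open>The source of the bound 2 on \<open>\<beta>\<close>. Points on equal or adjacent sides
  are joined along the boundary by a walk as long as the sum of the coordinate differences. For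
  opposite sides the two ways round have total length \<open>4 * r\<close>, so the shorter one has
  length at most \<open>2 * r\<close>, while the points are at least \<open>r\<close> apart.\<close>

lemma square_boundary_two_lipschitz:
  fixes v :: "real \<Rightarrow> real \<Rightarrow> real"
  assumes r: "0 \<le> r"
    and H: "\<And>x x' y. x \<in> {a..a+r} \<Longrightarrow> x' \<in> {a..a+r} \<Longrightarrow> y = b \<or> y = b + r \<Longrightarrow> \<bar>v x y - v x' y\<bar> \<le> \<bar>x - x'\<bar>"
    and V: "\<And>y y' x. y \<in> {b..b+r} \<Longrightarrow> y' \<in> {b..b+r} \<Longrightarrow> x = a \<or> x = a + r \<Longrightarrow> \<bar>v x y - v x y'\<bar> \<le> \<bar>y - y'\<bar>"
    and z: "x \<in> {a..a+r} \<and> (y = b \<or> y = b + r) \<or> y \<in> {b..b+r} \<and> (x = a \<or> x = a + r)"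
    and w: "x' \<in> {a..a+r} \<and> (y' = b \<or> y' = b + r) \<or> y' \<in> {b..b+r} \<and> (x' = a \<or> x' = a + r)"
    and m: "\<bar>x - x'\<bar> \<le> m" "\<bar>y - y'\<bar> \<le> m"
  shows "\<bar>v x y - v x' y'\<bar> \<le> 2 * m"
proof -
  have adjacent: "\<bar>v x y - v x' y'\<bar> \<le> 2 * m"
    if "x \<in> {a..a+r}" "y = b \<or> y = b + r" "y' \<in> {b..b+r}" "x' = a \<or> x' = a + r" and "\<bar>x - x'\<bar> \<le> m" "\<bar>y - y'\<bar> \<le> m" for x y x' y'
  proof -
    have "\<bar>v x y - v x' y\<bar> \<le> \<bar>x - x'\<bar>" using H[of x x' y] that r by auto
    moreover have "\<bar>v x' y - v x' y'\<bar> \<le> \<bar>y - y'\<bar>" using V[of y y' x'] that r by auto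
    ultimately show ?thesis using that by linarith
  qed
  have horizontal: "\<bar>v x y - v x' y'\<bar> \<le> 2 * m"
    if "x \<in> {a..a+r}" "y = b \<or> y = b + r" "x' \<in> {a..a+r}" "y' = b \<or> y' = b + r" and "\<bar>x - x'\<bar> \<le> m" "\<bar>y - y'\<bar> \<le> m" for x y x' y'
  proof (cases "y = y'")
    case True
    then show ?thesis using H[of x x' y] that by fastforce
  next
    case False
    then have "\<bar>y - y'\<bar> = r" using that r by auto
    moreover have "\<bar>v x y - v a y\<bar> \<le> x - a" "\<bar>v x' y' - v a y'\<bar> \<le> x' - a"
      "\<bar>v x y - v (a + r) y\<bar> \<le> a + r - x" "\<bar>v x' y' - v (a + r) y'\<bar> \<le> a + r - x'"
      using H[of x a y] H[of x' a y'] H[of x "a + r" y] H[of x' "a + r" y'] that r by auto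
    moreover have "\<bar>v a y - v a y'\<bar> \<le> \<bar>y - y'\<bar>" "\<bar>v (a + r) y - v (a + r) y'\<bar> \<le> \<bar>y - y'\<bar>"
      using V[of y y' a] V[of y y' "a + r"] that r by auto
    ultimately have "\<bar>v x y - v x' y'\<bar> \<le> 2 * r" by linarith
    then show ?thesis using \<open>\<bar>y - y'\<bar> = r\<close> that by linarith
  qed
  have vertical: "\<bar>v x y - v x' y'\<bar> \<le> 2 * m"
    if "y \<in> {b..b+r}" "x = a \<or> x = a + r" "y' \<in> {b..b+r}" "x' = a \<or> x' = a + r" and "\<bar>x - x'\<bar> \<le> m" "\<bar>y - y'\<bar> \<le> m" for x y x' y'
  proof (cases "x = x'")
    case True
    then show ?thesis using V[of y y' x] that by fastforce
  next
    case False
    then have "\<bar>x - x'\<bar> = r" using that r by auto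
    moreover have "\<bar>v x y - v x b\<bar> \<le> y - b" "\<bar>v x' y' - v x' b\<bar> \<le> y' - b"
      "\<bar>v x y - v x (b + r)\<bar> \<le> b + r - y" "\<bar>v x' y' - v x' (b + r)\<bar> \<le> b + r - y'"
      using V[of y b x] V[of y' b x'] V[of y "b + r" x] V[of y' "b + r" x'] that r by auto
    moreover have "\<bar>v x b - v x' b\<bar> \<le> \<bar>x - x'\<bar>" "\<bar>v x (b + r) - v x' (b + r)\<bar> \<le> \<bar>x - x'\<bar>"
      using H[of x x' b] H[of x x' "b + r"] that r by auto
    ultimately have "\<bar>v x y - v x' y'\<bar> \<le> 2 * r" by linarith
    then show ?thesis using \<open>\<bar>x - x'\<bar> = r\<close> that by linarith
  qed
  show ?thesis
    using z w
  proof (elim disjE conjE)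
  qed (use m adjacent[of x y y' x'] adjacent[of x' y' y x] horizontal[of x y x' y'] vertical[of y x y' x'] in
      \<open>simp_all add: abs_minus_commute\<close>)
qed

section \<open>The calibration\<close>

text \<open>Integer translates of a compact interval are locally finite. For the calibration this
  says that a neighbour lying in some strip or block shares that piece with the given point.\<close>

lemma near_periodic_interval:
  fixes y0 a b :: real
  shows "\<exists>e>0. \<forall>y. \<bar>y - y0\<bar> < e \<longrightarrow>
    (\<forall>j::int. y \<in> {real_of_int j + a..real_of_int j + b} \<longrightarrow> y0 \<in> {real_of_int j + a..real_of_int j + b})"
proof -
  \<comment> \<open>The distances from \<open>y0\<close> to the first translate above it and to the
    last translate below it.\<close>
  define e1 where "e1 = real_of_int \<lfloor>y0 - a\<rfloor> + 1 - (y0 - a)"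
  define e2 where "e2 = (y0 - b) - (real_of_int \<lceil>y0 - b\<rceil> - 1)"
  have pos: "0 < e1" "0 < e2" by (auto simp: e1_def e2_def; linarith)+
  have "y0 \<in> {real_of_int j + a..real_of_int j + b}"
    if y: "\<bar>y - y0\<bar> < min e1 e2" "y \<in> {real_of_int j + a..real_of_int j + b}" for y j
  proof (rule ccontr)
    assume "y0 \<notin> {real_of_int j + a..real_of_int j + b}"
    then consider "y0 - a < real_of_int j" | "real_of_int j < y0 - b" by fastforce
    then show False
    proof cases
      case 1
      then have "\<lfloor>y0 - a\<rfloor> + 1 \<le> j" by linarith
      then have "real_of_int \<lfloor>y0 - a\<rfloor> + 1 \<le> real_of_int j" by linarith
      then show False using y by (auto simp: e1_def)
    next
      case 2
      then have "j \<le> \<lceil>y0 - b\<rceil> - 1" by linarith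
      then have "real_of_int j \<le> real_of_int \<lceil>y0 - b\<rceil> - 1" by linarith
      then show False using y by (auto simp: e2_def)
    qed
  qed
  then show ?thesis using pos by (metis min_less_iff_conj)
qed

section \<open>Strips, blocks, obstacles and the potential on them\<close>

context obstacles
begin

definition hw :: real where "hw = gap / 2"

lemma hw: "gap = 2 * hw" "\<rho> = 1 - 2 * hw" "0 < hw" "4 * hw < 1"
  using rho by (simp_all add: hw_def field_simps)

text \<open>The rise of the potential from \<open>bot_gate i j 0\<close> to
  \<open>top_gate i j 0\<close>: of the rise \<open>q k\<close> over a full row, the block takes
  \<open>L\<close>.\<close>

definition tau :: "nat \<Rightarrow> real" where "tau k = q k - L"

definition strip :: "int \<Rightarrow> (real \<times> real) set" where
  "strip j = {z. snd z \<in> {real_of_int j + - hw..real_of_int j + hw}}"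

definition block :: "int \<Rightarrow> int \<Rightarrow> (real \<times> real) set" where
  "block i j = {z. fst z \<in> {real_of_int i + - hw..real_of_int i + hw} \<and>
                   snd z \<in> {real_of_int j + hw..real_of_int j + (1 - hw)}}"

definition obst :: "int \<Rightarrow> int \<Rightarrow> (real \<times> real) set" where
  "obst i j = box (real_of_int i + hw, real_of_int j + hw)
                  (real_of_int i + (1 - hw), real_of_int j + (1 - hw))"

text \<open>Half-open cells shifted by \<open>hw\<close>, each made of a piece of a strip, a block
  and an obstacle. The upper edge of a block counts for the next row, where it lies in the
  strip.\<close>

definition col :: "real \<times> real \<Rightarrow> int" where "col z = \<lfloor>fst z + hw\<rfloor>"

definition row :: "real \<times> real \<Rightarrow> int" where "row z = \<lfloor>snd z + hw\<rfloor>"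

lemma mem_obst:
  "z \<in> obst i j \<longleftrightarrow> real_of_int i + hw < fst z \<and> fst z < real_of_int i + (1 - hw) \<and>
     real_of_int j + hw < snd z \<and> snd z < real_of_int j + (1 - hw)"
  by (cases z) (auto simp: obst_def box_prod box_real)

lemma closure_obst:
  "closure (obst i j) = cbox (real_of_int i + hw, real_of_int j + hw)
                  (real_of_int i + (1 - hw), real_of_int j + (1 - hw))"
proof -
  have "(real_of_int i + 1 / 2, real_of_int j + 1 / 2) \<in> obst i j"
    using hw by (auto simp: mem_obst)
  then show ?thesis unfolding obst_def by (intro closure_box) auto
qed

lemma mem_closure_obst:
  "z \<in> closure (obst i j) \<longleftrightarrow> real_of_int i + hw \<le> fst z \<and> fst z \<le> real_of_int i + (1 - hw) \<and>
     real_of_int j + hw \<le> snd z \<and> snd z \<le> real_of_int j + (1 - hw)"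
  by (cases z) (auto simp: closure_obst cbox_prod)

lemma open_obst: "open (obst i j)"
  by (simp add: obst_def open_box)

lemma obst_col_row: "z \<in> obst i j \<Longrightarrow> col z = i \<and> row z = j"
  using hw unfolding mem_obst col_def row_def by (auto intro!: floor_unique)

lemma strip_row: "z \<in> strip j \<Longrightarrow> row z = j"
  using hw unfolding strip_def row_def by (auto intro!: floor_unique)

lemma block_col: "z \<in> block i j \<Longrightarrow> col z = i"
  using hw unfolding block_def col_def by (auto intro!: floor_unique)

lemma block_row: "z \<in> block i j \<Longrightarrow> snd z < real_of_int j + (1 - hw) \<Longrightarrow> row z = j"
  using hw unfolding block_def row_def by (auto intro!: floor_unique)

lemma col_row_bounds:
  "real_of_int (col z) \<le> fst z + hw" "fst z + hw < real_of_int (col z) + 1"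
  "real_of_int (row z) \<le> snd z + hw" "snd z + hw < real_of_int (row z) + 1"
  unfolding col_def row_def by linarith+

lemma piece_cases:
  obtains "z \<in> strip (row z)" | "z \<in> block (col z) (row z)" | "z \<in> obst (col z) (row z)"
  using col_row_bounds[of z] hw unfolding strip_def block_def mem_obst
  by (cases "snd z \<le> row z + hw"; cases "fst z \<le> col z + hw") auto

lemma frontier_obst_disjoint:
  assumes "z \<in> closure (obst i j)" "z \<notin> obst i j" shows "z \<notin> obst i' j'"
proof
  assume z: "z \<in> obst i' j'"
  then have "real_of_int i < real_of_int (i' + 1)" "real_of_int i' < real_of_int (i + 1)"
    "real_of_int j < real_of_int (j' + 1)" "real_of_int j' < real_of_int (j + 1)"
    using assms(1) hw unfolding mem_closure_obst mem_obst by simp_all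
  then have "i = i'" "j = j'" unfolding of_int_less_iff by auto
  then show False using z assms(2) by simp
qed

text \<open>
  The gates of the strip \<open>j\<close> are the segments where it meets the adjacent blocks, parametrised by the
  distance from the obstacle corners at which the optimal paths pass.
\<close>

definition top_gate :: "int \<Rightarrow> int \<Rightarrow> real \<Rightarrow> real \<times> real" where
  "top_gate i j t = (real_of_int i - hw + t, real_of_int j + hw)"

definition bot_gate :: "int \<Rightarrow> int \<Rightarrow> real \<Rightarrow> real \<times> real" where
  "bot_gate i j s = (real_of_int i + hw - s, real_of_int j - hw)"

text \<open>The parameter grows to the right on upper gates and to the left on lower ones, so with
  these signs of \<open>h\<close> the values increase to the right on both. Between consecutive
  corners of an optimal path they differ exactly by its length.\<close>

definition top_val :: "nat \<Rightarrow> int \<Rightarrow> int \<Rightarrow> real \<Rightarrow> real" where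
  "top_val k i j t = real_of_int i * p k + real_of_int j * q k + tau k + h k t"

definition bot_val :: "nat \<Rightarrow> int \<Rightarrow> int \<Rightarrow> real \<Rightarrow> real" where
  "bot_val k i j s = real_of_int i * p k + real_of_int j * q k - h k s"

lemma top_top:
  assumes "s \<in> {0..gap}" "t \<in> {0..gap}"
  shows "\<bar>top_val k i j s - top_val k i' j t\<bar> \<le> dist (top_gate i j s) (top_gate i' j t)"
  using gate_same[of s t "i - i'" k] assms
  by (simp add: top_val_def top_gate_def dist_eq_hyp hyp_0 algebra_simps)

lemma bot_bot:
  assumes "s \<in> {0..gap}" "t \<in> {0..gap}"
  shows "\<bar>bot_val k i j s - bot_val k i' j t\<bar> \<le> dist (bot_gate i j s) (bot_gate i' j t)"
  using gate_same[of t s "i - i'" k] assms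
  by (simp add: bot_val_def bot_gate_def dist_eq_hyp hyp_0 algebra_simps)

lemma top_bot:
  assumes "s \<in> {0..gap}" "t \<in> {0..gap}"
  shows "\<bar>top_val k i j t - bot_val k i' j s\<bar> \<le> dist (top_gate i j t) (bot_gate i' j s)"
proof -
  \<comment> \<open>The optimal crossing advances by \<open>k + 1\<close> columns; \<open>?m\<close>
    is the deviation from that.\<close>
  let ?m = "i - i' - 1 - int k"
  have "top_val k i j t - bot_val k i' j s = real_of_int ?m * p k + f (real k + \<rho>) + h k s + h k t"
    by (simp add: top_val_def bot_val_def tau_def q_def c_def algebra_simps)
  moreover have "dist (top_gate i j t) (bot_gate i' j s) = f (real k + \<rho> + (s + t) + real_of_int ?m)"
  proof -
    have "real_of_int j + hw - (real_of_int j - hw) = gap" using hw(1) by linarith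
    moreover have "real_of_int i - hw + t - (real_of_int i' + hw - s) =
        real k + \<rho> + (s + t) + real_of_int ?m" using hw(2) by simp
    ultimately show ?thesis unfolding top_gate_def bot_gate_def dist_eq_hyp by (simp only:)
  qed
  ultimately show ?thesis
    using gate_strip_upper[of s t ?m k] gate_strip_lower[of s t ?m k] assms
    by (simp add: abs_le_iff)
qed

lemma block_top_bot:
  assumes "s \<in> {0..gap}" "t \<in> {0..gap}"
  shows "\<bar>top_val k i j t - bot_val k i (j + 1) s\<bar> \<le> dist (top_gate i j t) (bot_gate i (j + 1) s)"
proof -
  have "top_val k i j t - bot_val k i (j + 1) s = - (L - h k s - h k t)"
    by (simp add: top_val_def bot_val_def tau_def algebra_simps)
  moreover have "dist (top_gate i j t) (bot_gate i (j + 1) s) = hyp (- \<rho>) (- (gap - s - t))"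
  proof -
    have "real_of_int j + hw - (real_of_int (j + 1) - hw) = - \<rho>" using hw(2) by simp
    moreover have "real_of_int i - hw + t - (real_of_int i + hw - s) = - (gap - s - t)"
      using hw(2) by simp
    ultimately show ?thesis unfolding top_gate_def bot_gate_def dist_eq_hyp by (simp only:)
  qed
  ultimately show ?thesis
    using gate_block[of s t k] assms
    by (simp only: hyp_minus_left hyp_minus abs_minus_cancel atLeastAtMost_iff)
qed

lemma strip_potential:
  obtains u where "\<And>i t. t \<in> {0..gap} \<Longrightarrow> u (top_gate i j t) = top_val k i j t"
    "\<And>i t. t \<in> {0..gap} \<Longrightarrow> u (bot_gate i j t) = bot_val k i j t"
    "\<And>z w. \<bar>u z - u w\<bar> \<le> dist z w"
proof -
  \<comment> \<open>The Boolean separates upper from lower gates; all gates of the strip enter a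
    single extension.\<close>
  define P where "P = (\<lambda>(b, i, t). if b then top_gate i j t else bot_gate i j t)"
  define v where "v = (\<lambda>(b, i, t). if b then top_val k i j t else bot_val k i j t)"
  have lip: "\<bar>v x - v y\<bar> \<le> 1 * dist (P x) (P y)"
    if "x \<in> UNIV \<times> UNIV \<times> {0..gap}" "y \<in> UNIV \<times> UNIV \<times> {0..gap}" for x y
    using that top_top bot_bot top_bot top_bot[THEN order_trans[OF eq_refl[OF abs_minus_commute]]]
    by (cases x; cases y; cases "fst x"; cases "fst y") (auto simp: P_def v_def dist_commute)
  show ?thesis
  proof (rule lipschitz_extension[of "UNIV \<times> UNIV \<times> {0..gap}" v 1 P])
    show "UNIV \<times> UNIV \<times> {0..gap} \<noteq> {}" using rho by auto
  next
    fix u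
    assume u: "\<And>x. x \<in> UNIV \<times> UNIV \<times> {0..gap} \<Longrightarrow> u (P x) = v x"
      "\<And>z w. \<bar>u z - u w\<bar> \<le> 1 * dist z w"
    show thesis
    proof (rule that[of u])
      show "u (top_gate i j t) = top_val k i j t" if "t \<in> {0..gap}" for i t
        using u(1)[of "(True, i, t)"] that by (simp add: P_def v_def)
      show "u (bot_gate i j t) = bot_val k i j t" if "t \<in> {0..gap}" for i t
        using u(1)[of "(False, i, t)"] that by (simp add: P_def v_def)
    qed (use u(2) in simp)
  qed (use lip in auto)
qed

lemma block_potential:
  obtains u where "\<And>t. t \<in> {0..gap} \<Longrightarrow> u (top_gate i j t) = top_val k i j t"
    "\<And>t. t \<in> {0..gap} \<Longrightarrow> u (bot_gate i (j + 1) t) = bot_val k i (j + 1) t"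
    "\<And>z w. \<bar>u z - u w\<bar> \<le> dist z w"
proof -
  define P where "P = (\<lambda>(b, t). if b then top_gate i j t else bot_gate i (j + 1) t)"
  define v where "v = (\<lambda>(b, t). if b then top_val k i j t else bot_val k i (j + 1) t)"
  have lip: "\<bar>v x - v y\<bar> \<le> 1 * dist (P x) (P y)"
    if "x \<in> UNIV \<times> {0..gap}" "y \<in> UNIV \<times> {0..gap}" for x y
    using that top_top bot_bot block_top_bot block_top_bot[THEN order_trans[OF eq_refl[OF abs_minus_commute]]]
    by (cases x; cases y; cases "fst x"; cases "fst y") (auto simp: P_def v_def dist_commute)
  show ?thesis
  proof (rule lipschitz_extension[of "UNIV \<times> {0..gap}" v 1 P])
    show "UNIV \<times> {0..gap} \<noteq> {}" using rho by auto
  next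
    fix u
    assume u: "\<And>x. x \<in> UNIV \<times> {0..gap} \<Longrightarrow> u (P x) = v x"
      "\<And>z w. \<bar>u z - u w\<bar> \<le> 1 * dist z w"
    show thesis
    proof (rule that[of u])
      show "u (top_gate i j t) = top_val k i j t" if "t \<in> {0..gap}" for t
        using u(1)[of "(True, t)"] that by (simp add: P_def v_def)
      show "u (bot_gate i (j + 1) t) = bot_val k i (j + 1) t" if "t \<in> {0..gap}" for t
        using u(1)[of "(False, t)"] that by (simp add: P_def v_def)
    qed (use u(2) in simp)
  qed (use lip in auto)
qed


lemma calibration_exists:
  obtains u C where
    "\<And>i j z w. z \<in> closure (obst i j) \<Longrightarrow> w \<in> closure (obst i j) \<Longrightarrow> \<bar>u z - u w\<bar> \<le> \<beta> * dist z w"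
    "\<And>z. z \<notin> (\<Union>i j. obst i j) \<Longrightarrow>
       \<exists>e>0. \<forall>w. dist w z < e \<and> w \<notin> (\<Union>i j. obst i j) \<longrightarrow> \<bar>u w - u z\<bar> \<le> dist w z"
    "\<And>z. \<bar>u z - (p k * fst z + q k * snd z)\<bar> \<le> C"
proof -
  have "\<forall>j. \<exists>u. (\<forall>i. \<forall>t\<in>{0..gap}. u (top_gate i j t) = top_val k i j t \<and> u (bot_gate i j t) = bot_val k i j t) \<and>
      (\<forall>z w. \<bar>u z - u w\<bar> \<le> dist z w)"
    using strip_potential by (metis (no_types))
  then obtain US where US: "\<And>i j t. t \<in> {0..gap} \<Longrightarrow> US j (top_gate i j t) = top_val k i j t"
      "\<And>i j t. t \<in> {0..gap} \<Longrightarrow> US j (bot_gate i j t) = bot_val k i j t"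
      "\<And>j z w. \<bar>US j z - US j w\<bar> \<le> dist z w"
    by metis
  have "\<forall>i j. \<exists>u. (\<forall>t\<in>{0..gap}. u (top_gate i j t) = top_val k i j t \<and> u (bot_gate i (j + 1) t) = bot_val k i (j + 1) t) \<and>
      (\<forall>z w. \<bar>u z - u w\<bar> \<le> dist z w)"
    using block_potential by (metis (no_types))
  then obtain UV where UV: "\<And>i j t. t \<in> {0..gap} \<Longrightarrow> UV i j (top_gate i j t) = top_val k i j t"
      "\<And>i j t. t \<in> {0..gap} \<Longrightarrow> UV i j (bot_gate i (j + 1) t) = bot_val k i (j + 1) t"
      "\<And>i j z w. \<bar>UV i j z - UV i j w\<bar> \<le> dist z w"
    by metis
  \<comment> \<open>Strip and block potentials agree on the gates, so the precedence given to strips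
    does no harm.\<close>
  define u0 where "u0 z = (if z \<in> strip (row z) then US (row z) z else UV (col z) (row z) z)" for z
  have u0_strip: "u0 z = US j z" if "z \<in> strip j" for z j
    using strip_row[OF that] that by (simp add: u0_def)
  have u0_block: "u0 z = UV i j z" if z: "z \<in> block i j" for z i j
  proof -
    have c: "col z = i" using block_col[OF z] .
    have x: "fst z - real_of_int i + hw \<in> {0..gap}" "real_of_int i + hw - fst z \<in> {0..gap}"
      using z hw by (auto simp: block_def)
    consider "snd z = real_of_int j + hw" | "snd z = real_of_int j + (1 - hw)"
      | "real_of_int j + hw < snd z" "snd z < real_of_int j + (1 - hw)"
      using z by (fastforce simp: block_def)
    then show ?thesis
    proof cases
      case 1
      then have eq: "z = top_gate i j (fst z - real_of_int i + hw)"
        by (simp add: top_gate_def prod_eq_iff)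
      have "z \<in> strip j" using 1 hw by (simp add: strip_def)
      then show ?thesis using u0_strip US(1)[OF x(1), of j i] UV(1)[OF x(1), of i j] eq by simp
    next
      case 2
      then have eq: "z = bot_gate i (j + 1) (real_of_int i + hw - fst z)"
        by (simp add: bot_gate_def prod_eq_iff)
      have "z \<in> strip (j + 1)" using 2 hw by (simp add: strip_def)
      then show ?thesis using u0_strip US(2)[OF x(2), of "j + 1" i] UV(2)[OF x(2), of i j] eq by simp
    next
      case 3
      then have r: "row z = j" using block_row[OF z] by simp
      have "z \<notin> strip j" using 3 by (simp add: strip_def)
      then show ?thesis by (simp add: u0_def c r)
    qed
  qed
  have u0_same_strip: "\<bar>u0 z - u0 w\<bar> \<le> dist z w" if "z \<in> strip j" "w \<in> strip j" for z w j
    using u0_strip[OF that(1)] u0_strip[OF that(2)] US(3)[of j z w] by simp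
  have u0_same_block: "\<bar>u0 z - u0 w\<bar> \<le> dist z w" if "z \<in> block i j" "w \<in> block i j" for z w i j
    using u0_block[OF that(1)] u0_block[OF that(2)] UV(3)[of i j z w] by simp
  have boundary: "\<bar>u0 z - u0 w\<bar> \<le> \<beta> * dist z w"
    if z: "z \<in> closure (obst i j) - obst i j" and w: "w \<in> closure (obst i j) - obst i j" for z w i j
  proof -
    let ?a = "real_of_int i + hw" and ?b = "real_of_int j + hw" and ?r = "1 - 2 * hw"
    \<comment> \<open>Horizontal sides of an obstacle lie in strips and vertical sides in blocks, so
      \<open>u0\<close> is 1-Lipschitz along each side.\<close>
    have "\<bar>u0 (fst z, snd z) - u0 (fst w, snd w)\<bar> \<le> 2 * dist z w"
    proof (rule square_boundary_two_lipschitz[where a = ?a and b = ?b and r = ?r and v = "\<lambda>x y. u0 (x, y)"])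
      show "0 \<le> ?r" using hw by simp
      show "\<bar>u0 (x, y) - u0 (x', y)\<bar> \<le> \<bar>x - x'\<bar>"
        if "x \<in> {?a..?a + ?r}" "x' \<in> {?a..?a + ?r}" "y = ?b \<or> y = ?b + ?r" for x x' y
      proof -
        have "(x, y) \<in> strip j \<and> (x', y) \<in> strip j \<or> (x, y) \<in> strip (j + 1) \<and> (x', y) \<in> strip (j + 1)"
          using that(3) hw by (auto simp: strip_def)
        then have "\<bar>u0 (x, y) - u0 (x', y)\<bar> \<le> dist (x, y) (x', y)" using u0_same_strip by blast
        then show ?thesis by (simp add: dist_eq_hyp hyp_0)
      qed
      show "\<bar>u0 (x, y) - u0 (x, y')\<bar> \<le> \<bar>y - y'\<bar>"
        if "y \<in> {?b..?b + ?r}" "y' \<in> {?b..?b + ?r}" "x = ?a \<or> x = ?a + ?r" for y y' x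
      proof -
        have "(x, y) \<in> block i j \<and> (x, y') \<in> block i j \<or> (x, y) \<in> block (i + 1) j \<and> (x, y') \<in> block (i + 1) j"
          using that hw by (auto simp: block_def)
        then have "\<bar>u0 (x, y) - u0 (x, y')\<bar> \<le> dist (x, y) (x, y')" using u0_same_block by blast
        then show ?thesis by (simp add: dist_Pair_Pair dist_real_def)
      qed
      show "fst z \<in> {?a..?a + ?r} \<and> (snd z = ?b \<or> snd z = ?b + ?r) \<or>
          snd z \<in> {?b..?b + ?r} \<and> (fst z = ?a \<or> fst z = ?a + ?r)"
        using z hw unfolding mem_closure_obst mem_obst Diff_iff atLeastAtMost_iff by (smt (verit))
      show "fst w \<in> {?a..?a + ?r} \<and> (snd w = ?b \<or> snd w = ?b + ?r) \<or>
          snd w \<in> {?b..?b + ?r} \<and> (fst w = ?a \<or> fst w = ?a + ?r)"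
        using w hw unfolding mem_closure_obst mem_obst Diff_iff atLeastAtMost_iff by (smt (verit))
    qed (use dist_prod_bounds in auto)
    moreover have "2 * dist z w \<le> \<beta> * dist z w" using beta by (intro mult_right_mono) auto
    ultimately show ?thesis by simp
  qed
  have "\<exists>u. (\<forall>z\<in>closure (obst i j) - obst i j. u z = u0 z) \<and> (\<forall>z w. \<bar>u z - u w\<bar> \<le> \<beta> * dist z w)" for i j
  proof (rule lipschitz_extension[of "closure (obst i j) - obst i j" u0 \<beta> "\<lambda>z. z"])
    have "(real_of_int i + hw, real_of_int j + hw) \<in> closure (obst i j) - obst i j"
      using hw by (simp add: mem_closure_obst mem_obst)
    then show "closure (obst i j) - obst i j \<noteq> {}" by blast
    show "\<bar>u0 z - u0 w\<bar> \<le> \<beta> * dist z w"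
      if "z \<in> closure (obst i j) - obst i j" "w \<in> closure (obst i j) - obst i j" for z w
      using boundary[OF that] .
    show "0 \<le> \<beta>" using beta by simp
  qed blast
  then obtain UQ where UQ: "\<And>i j z. z \<in> closure (obst i j) - obst i j \<Longrightarrow> UQ i j z = u0 z"
      "\<And>i j z w. \<bar>UQ i j z - UQ i j w\<bar> \<le> \<beta> * dist z w"
    by metis
  define u where "u z = (if z \<in> obst (col z) (row z) then UQ (col z) (row z) z else u0 z)" for z
  have u_free: "u z = u0 z" if "z \<notin> (\<Union>i j. obst i j)" for z
    using that by (auto simp: u_def)
  have u_obst: "u z = UQ i j z" if z: "z \<in> closure (obst i j)" for z i j
  proof (cases "z \<in> obst i j")
    case True
    then show ?thesis using obst_col_row[OF True] by (simp add: u_def)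
  next
    case False
    then have "u z = u0 z" using frontier_obst_disjoint[OF z False] by (simp add: u_def)
    then show ?thesis using UQ(1) z False by simp
  qed
  have strip_free: "z \<notin> obst i' j'" if z: "z \<in> strip j" for z j i' j'
  proof
    assume a: "z \<in> obst i' j'"
    then have "j' = j" using obst_col_row[OF a] strip_row[OF z] by simp
    then show False using a z by (simp add: mem_obst strip_def)
  qed
  have block_free: "z \<notin> obst i' j'" if z: "z \<in> block i j" for z i j i' j'
  proof
    assume a: "z \<in> obst i' j'"
    then have "i' = i" using obst_col_row[OF a] block_col[OF z] by simp
    then show False using a z by (simp add: mem_obst block_def)
  qed
  show ?thesis
  proof (rule that[of u])
    show "\<bar>u z - u w\<bar> \<le> \<beta> * dist z w" if "z \<in> closure (obst i j)" "w \<in> closure (obst i j)" for i j z w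
      using u_obst[OF that(1)] u_obst[OF that(2)] UQ(2)[of i j z w] by simp
  next
    fix z assume z: "z \<notin> (\<Union>i j. obst i j)"
    \<comment> \<open>These radii exclude all strips and blocks that do not contain
      \<open>z\<close>.\<close>
    obtain e1 where e1: "e1 > 0" "\<And>y j. \<bar>y - snd z\<bar> < e1 \<Longrightarrow> y \<in> {real_of_int j + - hw..real_of_int j + hw} \<Longrightarrow>
        snd z \<in> {real_of_int j + - hw..real_of_int j + hw}"
      using near_periodic_interval[of "snd z" "- hw" hw] by blast
    obtain e2 where e2: "e2 > 0" "\<And>x i. \<bar>x - fst z\<bar> < e2 \<Longrightarrow> x \<in> {real_of_int i + - hw..real_of_int i + hw} \<Longrightarrow>
        fst z \<in> {real_of_int i + - hw..real_of_int i + hw}"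
      using near_periodic_interval[of "fst z" "- hw" hw] by blast
    obtain e3 where e3: "e3 > 0" "\<And>y j. \<bar>y - snd z\<bar> < e3 \<Longrightarrow> y \<in> {real_of_int j + hw..real_of_int j + (1 - hw)} \<Longrightarrow>
        snd z \<in> {real_of_int j + hw..real_of_int j + (1 - hw)}"
      using near_periodic_interval[of "snd z" "hw" "1 - hw"] by blast
    have "\<bar>u w - u z\<bar> \<le> dist w z"
      if w: "dist w z < min e1 (min e2 e3)" "w \<notin> (\<Union>i j. obst i j)" for w
    proof -
      have near: "\<bar>fst w - fst z\<bar> < min e1 (min e2 e3)" "\<bar>snd w - snd z\<bar> < min e1 (min e2 e3)"
        using dist_prod_bounds[of w z] w(1) by auto
      show ?thesis
      proof (cases rule: piece_cases[of w])
        case 1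
        then have "z \<in> strip (row w)" using e1(2)[of "snd w" "row w"] near by (simp add: strip_def)
        then show ?thesis using u0_same_strip[OF 1] u_free z w(2) by simp
      next
        case 2
        then have "z \<in> block (col w) (row w)"
          using e2(2)[of "fst w" "col w"] e3(2)[of "snd w" "row w"] near by (simp add: block_def)
        then show ?thesis using u0_same_block[OF 2] u_free z w(2) by simp
      next
        case 3
        then show ?thesis using w(2) by blast
      qed
    qed
    then show "\<exists>e>0. \<forall>w. dist w z < e \<and> w \<notin> (\<Union>i j. obst i j) \<longrightarrow> \<bar>u w - u z\<bar> \<le> dist w z"
      using e1(1) e2(1) e3(1) by (intro exI[of _ "min e1 (min e2 e3)"]) auto
  next
    fix z :: "real \<times> real"
    let ?i = "real_of_int (col z)" and ?j = "real_of_int (row z)"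
    \<comment> \<open>This corner belongs to the strip, the block and the closed obstacle of the
      cell of \<open>z\<close>. Comparison with it bounds the distance to the linear function
      uniformly over all cells.\<close>
    let ?R = "top_gate (col z) (row z) gap"
    have Rs: "?R \<in> strip (row z)" and Rb: "?R \<in> block (col z) (row z)"
      and Ro: "?R \<in> closure (obst (col z) (row z))"
      using hw by (auto simp: top_gate_def strip_def block_def mem_closure_obst)
    have R_free: "?R \<notin> (\<Union>i j. obst i j)" using strip_free[OF Rs] by blast
    have xy: "\<bar>fst z - ?i\<bar> \<le> 1" "\<bar>snd z - ?j\<bar> \<le> 1"
      using col_row_bounds[of z] hw by (auto simp: abs_le_iff)
    have "dist z ?R \<le> \<bar>fst z - fst ?R\<bar> + \<bar>snd z - snd ?R\<bar>" by (rule dist_prod_bounds)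
    also have "\<dots> \<le> 2"
      using col_row_bounds[of z] hw by (auto simp: top_gate_def abs_if)
    finally have d: "dist z ?R \<le> 2" .
    have near: "\<bar>u z - u ?R\<bar> \<le> \<beta> * dist z ?R"
    proof -
      have le: "dist z ?R \<le> \<beta> * dist z ?R" using beta mult_right_mono[of 1 \<beta> "dist z ?R"] by simp
      show ?thesis
      proof (cases rule: piece_cases[of z])
        case 1
        then have "z \<notin> (\<Union>i j. obst i j)" using strip_free by blast
        then show ?thesis using u0_same_strip[OF 1 Rs] u_free R_free le by simp
      next
        case 2
        then have "z \<notin> (\<Union>i j. obst i j)" using block_free by blast
        then show ?thesis using u0_same_block[OF 2 Rb] u_free R_free le by simp
      next
        case 3
        then have "z \<in> closure (obst (col z) (row z))" using closure_subset by blast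
        then show ?thesis using u_obst Ro UQ(2) by simp
      qed
    qed
    have "u ?R = top_val k (col z) (row z) gap"
      using u_free[OF R_free] u0_strip[OF Rs] US(1)[of gap "row z" "col z"] rho by simp
    then have "u ?R - (p k * fst z + q k * snd z) = p k * (?i - fst z) + q k * (?j - snd z) + tau k + h k gap"
      by (simp add: top_val_def algebra_simps)
    moreover have "\<bar>p k * (?i - fst z)\<bar> \<le> \<bar>p k\<bar> * 1" "\<bar>q k * (?j - snd z)\<bar> \<le> \<bar>q k\<bar> * 1"
      unfolding abs_mult using xy by (intro mult_left_mono; simp add: abs_minus_commute)+
    moreover have "\<beta> * dist z ?R \<le> \<beta> * 2" using d beta by (intro mult_left_mono) auto
    ultimately show "\<bar>u z - (p k * fst z + q k * snd z)\<bar> \<le> \<beta> * 2 + \<bar>p k\<bar> + \<bar>q k\<bar> + \<bar>tau k\<bar> + \<bar>h k gap\<bar>"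
      using near by linarith
  qed
qed

end

section \<open>Polygonal paths\<close>

text \<open>The fundamental theorem with finitely many exceptional times, applied to the product of
  test function and path; its boundary values vanish.\<close>

lemma sobolev_path_piecewise:
  assumes cont: "continuous_on {0..1} \<gamma>" and "finite S"
    and deriv: "\<And>t. t \<in> {0<..<1} - S \<Longrightarrow> (\<gamma> has_vector_derivative g t) (at t)"
    and g: "g absolutely_integrable_on {0<..<1}"
  shows "sobolev_path \<gamma> g"
  unfolding sobolev_path_def
proof (intro conjI allI impI cont g)
  fix \<phi> \<phi>' :: "real \<Rightarrow> real"
  assume t: "test_fun \<phi> \<phi>'"
  have d\<phi>: "(\<phi> has_real_derivative \<phi>' t) (at t)" for t using t by (simp add: test_fun_def)
  have c\<phi>: "continuous_on {0..1} \<phi>"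
    using d\<phi> DERIV_isCont continuous_at_imp_continuous_on by blast
  have c\<phi>': "continuous_on {0..1} \<phi>'" using t continuous_on_subset by (auto simp: test_fun_def)
  have "\<phi> 0 = 0" "\<phi> 1 = 0"
    using t closure_subset[of "{t. \<phi> t \<noteq> 0}"] by (auto simp: test_fun_def)
  have i1: "(\<lambda>x. \<phi>' x *\<^sub>R \<gamma> x) absolutely_integrable_on {0<..<1}"
    by (rule set_integrable_subset[OF absolutely_integrable_continuous_real])
       (auto intro!: continuous_intros c\<phi>' cont)
  have i2: "(\<lambda>x. \<phi> x *\<^sub>R g x) absolutely_integrable_on {0<..<1}"
    by (rule absolutely_integrable_continuous_scaleR[OF c\<phi> g])
  have "((\<lambda>x. \<phi> x *\<^sub>R g x + \<phi>' x *\<^sub>R \<gamma> x) has_integral \<phi> 1 *\<^sub>R \<gamma> 1 - \<phi> 0 *\<^sub>R \<gamma> 0) {0..1}"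
  proof (rule fundamental_theorem_of_calculus_interior_strong[OF \<open>finite S\<close>])
    show "((\<lambda>x. \<phi> x *\<^sub>R \<gamma> x) has_vector_derivative \<phi> x *\<^sub>R g x + \<phi>' x *\<^sub>R \<gamma> x) (at x)"
      if "x \<in> {0<..<1} - S" for x
      using that by (intro has_vector_derivative_scaleR d\<phi> deriv)
    show "continuous_on {0..1} (\<lambda>x. \<phi> x *\<^sub>R \<gamma> x)" by (intro continuous_intros c\<phi> cont)
  qed auto
  then have "integral {0..1} (\<lambda>x. \<phi> x *\<^sub>R g x + \<phi>' x *\<^sub>R \<gamma> x) = 0"
    using \<open>\<phi> 0 = 0\<close> \<open>\<phi> 1 = 0\<close> by (simp add: integral_unique)
  then have "integral {0<..<1} (\<lambda>x. \<phi> x *\<^sub>R g x) + integral {0<..<1} (\<lambda>x. \<phi>' x *\<^sub>R \<gamma> x) = 0"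
    using set_lebesgue_integral_eq_integral(1)[OF i1] set_lebesgue_integral_eq_integral(1)[OF i2]
    by (simp add: integral_open_interval_real integral_add)
  then show "(LINT t:{0<..<1}|lebesgue. \<phi>' t *\<^sub>R \<gamma> t) = - (LINT t:{0<..<1}|lebesgue. \<phi> t *\<^sub>R g t)"
    using i1 i2 by (simp add: set_lebesgue_integral_eq_integral(2) eq_neg_iff_add_eq_0 add.commute)
qed

definition clamp01 :: "real \<Rightarrow> real" where "clamp01 x = max 0 (min 1 x)"

lemma clamp01_deriv:
  assumes "real n * t - real i \<notin> {0, 1}"
  shows "((\<lambda>t. clamp01 (real n * t - real i)) has_vector_derivative
    (if 0 < real n * t - real i \<and> real n * t - real i < 1 then real n else 0)) (at t)"
proof -
  let ?l = "\<lambda>t. real n * t - real i"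
  have l: "open {t. ?l t < 0}" "open {t. 0 < ?l t \<and> ?l t < 1}" "open {t. 1 < ?l t}"
    by (auto intro!: open_Collect_less open_Collect_conj continuous_intros)
  consider "?l t < 0" | "0 < ?l t" "?l t < 1" | "1 < ?l t" using assms by fastforce
  then have "((\<lambda>t. clamp01 (?l t)) has_real_derivative
    (if 0 < ?l t \<and> ?l t < 1 then real n else 0)) (at t)"
  proof cases
    case 1
    have "((\<lambda>t. clamp01 (?l t)) has_real_derivative 0) (at t)"
      by (rule has_field_derivative_transform_within_open[where S = "{t. ?l t < 0}" and f = "\<lambda>_. 0"])
         (use 1 l in \<open>auto simp: clamp01_def\<close>)
    then show ?thesis using 1 by auto
  next
    case 2
    have "(?l has_real_derivative real n) (at t)" by (auto intro!: derivative_eq_intros)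
    then have "((\<lambda>t. clamp01 (?l t)) has_real_derivative real n) (at t)"
      by (rule has_field_derivative_transform_within_open[where S = "{t. 0 < ?l t \<and> ?l t < 1}"])
         (use 2 l in \<open>auto simp: clamp01_def\<close>)
    then show ?thesis using 2 by auto
  next
    case 3
    have "((\<lambda>t. clamp01 (?l t)) has_real_derivative 0) (at t)"
      by (rule has_field_derivative_transform_within_open[where S = "{t. 1 < ?l t}" and f = "\<lambda>_. 1"])
         (use 3 l in \<open>auto simp: clamp01_def\<close>)
    then show ?thesis using 3 by auto
  qed
  then show ?thesis by (simp add: has_real_derivative_iff_has_vector_derivative)
qed

lemma polygon_cost:
  fixes P :: "nat \<Rightarrow> real \<times> real" and a :: "real \<times> real \<Rightarrow> real"
  assumes n: "0 < n" and P0: "P 0 = 0"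
    and \<kappa>: "\<And>i s. i < n \<Longrightarrow> s \<in> {0..1} \<Longrightarrow> a (P i + s *\<^sub>R (P (Suc i) - P i)) \<le> \<kappa> i"
    and a0: "\<And>z. 0 \<le> a z"
  shows "\<exists>\<gamma> g. sobolev_path \<gamma> g \<and> \<gamma> 0 = 0 \<and> \<gamma> 1 = P n \<and>
    (LINT t:{0<..<1}|lebesgue. a (\<gamma> t) * norm (g t)) \<le> (\<Sum>i<n. \<kappa> i * norm (P (Suc i) - P i))"
proof -
  define \<Delta> where "\<Delta> i = P (Suc i) - P i" for i
  define I where "I i = {t. 0 < real n * t - real i \<and> real n * t - real i < 1}" for i
  \<comment> \<open>The summand \<open>i\<close> changes only during the time slot
    \<open>I i\<close>, in which the path runs through edge \<open>i\<close> at constant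
    speed.\<close>
  define \<gamma> where "\<gamma> t = (\<Sum>i<n. clamp01 (real n * t - real i) *\<^sub>R \<Delta> i)" for t
  define g where "g t = (\<Sum>i<n. indicator (I i) t *\<^sub>R (real n *\<^sub>R \<Delta> i))" for t
  have I_eq: "I i = {real i / real n<..<(real i + 1) / real n}" for i
    using n by (auto simp: I_def field_simps)
  have tele: "(\<Sum>i<m. \<Delta> i) = P m" for m
    using sum_lessThan_telescope[of P m] P0 by (simp add: \<Delta>_def)
  have at0: "\<gamma> 0 = 0" by (simp add: \<gamma>_def clamp01_def)
  have "clamp01 (real n * 1 - real i) = 1" if "i < n" for i
    using that by (auto simp: clamp01_def)
  then have at1: "\<gamma> 1 = P n" using tele[of n] by (simp add: \<gamma>_def)
  have meas: "I i \<in> sets lebesgue" "emeasure lebesgue (I i) = 1 / real n" for i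
    using n by (auto simp: I_eq field_simps emeasure_lborel_Ioo)
  have ind_int: "integrable lebesgue (\<lambda>t. indicator (I i) t :: real)" for i
    using meas[of i] by (intro integrable_real_indicator) auto
  have g_int: "g absolutely_integrable_on {0<..<1}"
  proof -
    have "integrable lebesgue g"
      unfolding g_def by (intro Bochner_Integration.integrable_sum integrable_scaleR_left ind_int)
    then show ?thesis
      by (auto simp: set_integrable_def intro: integrable_mult_indicator)
  qed
  have "sobolev_path \<gamma> g"
  proof (rule sobolev_path_piecewise[where S = "(\<lambda>i. real i / real n) ` {..n}"])
    show "continuous_on {0..1} \<gamma>"
      unfolding \<gamma>_def clamp01_def by (intro continuous_intros)
    show "(\<gamma> has_vector_derivative g t) (at t)" if t: "t \<in> {0<..<1} - (\<lambda>i. real i / real n) ` {..n}" for t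
    proof -
      have "((\<lambda>t. clamp01 (real n * t - real i) *\<^sub>R \<Delta> i) has_vector_derivative
          indicator (I i) t *\<^sub>R (real n *\<^sub>R \<Delta> i)) (at t)" if i: "i < n" for i
      proof -
        have "real n * t - real i \<noteq> 0" "real n * t - real i \<noteq> 1"
        proof -
          have "real j / real n \<in> (\<lambda>i. real i / real n) ` {..n}" if "j \<le> n" for j
            using that by (intro imageI) simp
          from this[of i] this[of "Suc i"]
          have "t \<noteq> real i / real n" "t \<noteq> real (Suc i) / real n" using t i by auto
          then show "real n * t - real i \<noteq> 0" "real n * t - real i \<noteq> 1" using n by (auto simp: field_simps)
        qed
        then have "((\<lambda>t. clamp01 (real n * t - real i)) has_real_derivative
            (if t \<in> I i then real n else 0)) (at t)"
          using clamp01_deriv[of n t i] by (simp add: I_def has_real_derivative_iff_has_vector_derivative)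
        then have "((\<lambda>t. clamp01 (real n * t - real i) *\<^sub>R \<Delta> i) has_vector_derivative
            (clamp01 (real n * t - real i) *\<^sub>R 0 + (if t \<in> I i then real n else 0) *\<^sub>R \<Delta> i)) (at t)"
          by (rule has_vector_derivative_scaleR) auto
        then show ?thesis by (auto simp: indicator_def)
      qed
      then show ?thesis unfolding \<gamma>_def[abs_def] g_def by (intro has_vector_derivative_sum) auto
    qed
  qed (use g_int in auto)
  moreover have "(LINT t:{0<..<1}|lebesgue. a (\<gamma> t) * norm (g t)) \<le> (\<Sum>i<n. \<kappa> i * norm (\<Delta> i))"
  proof -
    define F where "F t = (\<Sum>i<n. indicator (I i) t * (\<kappa> i * (real n * norm (\<Delta> i))))" for t
    have \<kappa>0: "0 \<le> \<kappa> i" if "i < n" for i using order_trans[OF a0 \<kappa>[OF that, of 0]] by simp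
    have F0: "0 \<le> F t" for t
      unfolding F_def using \<kappa>0 by (intro sum_nonneg) (auto intro!: mult_nonneg_nonneg)
    have Fint: "integrable lebesgue F"
      unfolding F_def by (intro Bochner_Integration.integrable_sum integrable_mult_left ind_int)
    have "a (\<gamma> t) * norm (g t) \<le> F t" for t
    proof (cases "\<exists>i<n. t \<in> I i")
      case True
      then obtain i where i: "i < n" "t \<in> I i" by blast
      have uniq: "t \<in> I j \<longleftrightarrow> j = i" for j
      proof
        assume "t \<in> I j"
        then have "real i < real j + 1" "real j < real i + 1" using i(2) by (auto simp: I_def)
        then show "j = i" by linarith
      qed (use i in simp)
      have sum_ind: "(\<Sum>j<n. indicator (I j) t *\<^sub>R x j) = x i" for x :: "nat \<Rightarrow> 'z::real_vector"
      proof -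
        have "indicator (I j) t *\<^sub>R x j = (if j = i then x j else 0)" for j
          by (simp add: indicator_def uniq)
        then show ?thesis using i(1) by simp
      qed
      have g: "g t = real n *\<^sub>R \<Delta> i" unfolding g_def by (rule sum_ind)
      have F: "F t = \<kappa> i * (real n * norm (\<Delta> i))"
        unfolding F_def using sum_ind[of "\<lambda>i. \<kappa> i * (real n * norm (\<Delta> i))"] by simp
      let ?s = "real n * t - real i"
      have s: "0 < ?s" "?s < 1" using i(2) by (auto simp: I_def)
      have "clamp01 (real n * t - real j) = (if j < i then 1 else if j = i then ?s else 0)" for j
      proof -
        consider "real j \<le> real i - 1" | "j = i" | "real j \<ge> real i + 1" by linarith
        then show ?thesis using s by cases (auto simp: clamp01_def)
      qed
      then have "\<gamma> t = (\<Sum>j<n. (if j < i then \<Delta> j else 0) + (if j = i then ?s *\<^sub>R \<Delta> i else 0))"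
        unfolding \<gamma>_def by (intro sum.cong) auto
      also have "\<dots> = (\<Sum>j<n. if j < i then \<Delta> j else 0) + ?s *\<^sub>R \<Delta> i"
        using i(1) by (simp add: sum.distrib sum.delta)
      also have "(\<Sum>j<n. if j < i then \<Delta> j else 0) = (\<Sum>j<i. \<Delta> j)"
        using i(1) by (intro sum.mono_neutral_cong_right) auto
      finally have "\<gamma> t = P i + ?s *\<^sub>R (P (Suc i) - P i)" using tele by (simp add: \<Delta>_def)
      then have "a (\<gamma> t) \<le> \<kappa> i" using \<kappa>[OF i(1), of ?s] s by simp
      then show ?thesis by (simp add: g F mult_right_mono)
    next
      case False
      \<comment> \<open>Off the open time slots, in particular at the vertices, the chosen
        derivative is 0, so \<open>F\<close> dominates at every time and not merely almost
        everywhere.\<close>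
      then have "g t = 0" by (auto simp: g_def indicator_def intro!: sum.neutral)
      then show ?thesis using F0 by simp
    qed
    then have "indicator {0<..<1} t *\<^sub>R (a (\<gamma> t) * norm (g t)) \<le> F t" for t
      using F0[of t] by (auto simp: indicator_def)
    then have "(LINT t:{0<..<1}|lebesgue. a (\<gamma> t) * norm (g t)) \<le> integral\<^sup>L lebesgue F"
      unfolding set_lebesgue_integral_def using Fint F0 by (intro integral_mono') auto
    also have "\<dots> = (\<Sum>i<n. 1 / real n * (\<kappa> i * (real n * norm (\<Delta> i))))"
    proof -
      have "measure lebesgue (I i) = 1 / real n" for i using meas(2)[of i] n by (simp add: measure_def)
      moreover have "I i \<inter> space lebesgue = I i" for i by simp
      ultimately show ?thesis
        unfolding F_def using ind_int
        by (subst Bochner_Integration.integral_sum) (auto intro!: sum.cong)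
    qed
    also have "\<dots> = (\<Sum>i<n. \<kappa> i * norm (\<Delta> i))" using n by simp
    finally show ?thesis .
  qed
  ultimately show ?thesis using at0 at1 unfolding \<Delta>_def by blast
qed

text \<open>The inductive form lets paths grow edge by edge without bookkeeping of vertex
  indices.\<close>

inductive polyline :: "(real \<times> real \<Rightarrow> real) \<Rightarrow> real \<times> real \<Rightarrow> real \<Rightarrow> bool" for a where
  start: "polyline a 0 0"
| step: "polyline a z c \<Longrightarrow> (\<And>s. s \<in> {0..1} \<Longrightarrow> a (z + s *\<^sub>R v) \<le> \<kappa>) \<Longrightarrow>
    polyline a (z + v) (c + \<kappa> * norm v)"

lemma polyline_polygon:
  assumes "polyline a z c"
  shows "\<exists>n P \<kappa>. 0 < n \<and> P 0 = 0 \<and> P n = z \<and>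
    (\<forall>i<n. \<forall>s\<in>{0..1}. a (P i + s *\<^sub>R (P (Suc i) - P i)) \<le> \<kappa> i) \<and>
    c = (\<Sum>i<n. \<kappa> i * norm (P (Suc i) - P i))"
  using assms
proof induction
  case start
  \<comment> \<open>A degenerate edge at the origin, because \<open>polygon_cost\<close> wants at
    least one edge.\<close>
  show ?case by (rule exI[of _ 1], rule exI[of _ "\<lambda>_. 0"], rule exI[of _ "\<lambda>_. a 0"]) simp
next
  case (step z c v \<kappa>)
  then obtain n P \<kappa>' where P: "0 < n" "P 0 = 0" "P n = z"
      "\<And>i s. i < n \<Longrightarrow> s \<in> {0..1} \<Longrightarrow> a (P i + s *\<^sub>R (P (Suc i) - P i)) \<le> \<kappa>' i"
      "c = (\<Sum>i<n. \<kappa>' i * norm (P (Suc i) - P i))"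
    by blast
  let ?P = "P(Suc n := z + v)" and ?\<kappa> = "\<kappa>'(n := \<kappa>)"
  have "a (?P i + s *\<^sub>R (?P (Suc i) - ?P i)) \<le> ?\<kappa> i" if "i < Suc n" "s \<in> {0..1}" for i s
    using P(3) P(4)[of i s] step.hyps(2)[of s] that by (cases "i = n") auto
  moreover have "(\<Sum>i<n. ?\<kappa> i * norm (?P (Suc i) - ?P i)) = c"
    unfolding P(5) by (intro sum.cong) auto
  then have "c + \<kappa> * norm v = (\<Sum>i<Suc n. ?\<kappa> i * norm (?P (Suc i) - ?P i))"
    using P(3) by simp
  ultimately show ?case
    using P(2) by (intro exI[of _ "Suc n"] exI[of _ ?P] exI[of _ ?\<kappa>]) auto
qed

section \<open>The coefficient and the costs of paths at scale \<open>\<epsilon>\<close>\<close>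

context obstacles
begin

abbreviation solid :: "(real \<times> real) set" where "solid \<equiv> (\<Union>i j. obst i j)"

abbreviation coeff :: "real \<times> real \<Rightarrow> real" where "coeff \<equiv> coeff_fun \<rho> \<beta>"

definition costs :: "real \<Rightarrow> real \<times> real \<Rightarrow> real set" where
  "costs \<epsilon> \<xi> = {LINT t:{0<..<1}|lebesgue. coeff (\<gamma> t /\<^sub>R \<epsilon>) * norm (g t) |\<gamma> g.
            sobolev_path \<gamma> g \<and> \<gamma> 0 = 0 \<and> \<gamma> 1 = \<xi>}"

lemma frac_mem_iff:
  "frac x \<in> {hw<..<1 - hw} \<longleftrightarrow> (\<exists>i::int. real_of_int i + hw < x \<and> x < real_of_int i + (1 - hw))"
proof
  assume "frac x \<in> {hw<..<1 - hw}"
  then show "\<exists>i::int. real_of_int i + hw < x \<and> x < real_of_int i + (1 - hw)"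
    by (intro exI[of _ "\<lfloor>x\<rfloor>"]) (auto simp: frac_def)
next
  assume "\<exists>i::int. real_of_int i + hw < x \<and> x < real_of_int i + (1 - hw)"
  then obtain i :: int where i: "real_of_int i + hw < x" "x < real_of_int i + (1 - hw)" by blast
  then have "\<lfloor>x\<rfloor> = i" using hw by (intro floor_unique) auto
  then show "frac x \<in> {hw<..<1 - hw}" using i by (auto simp: frac_def)
qed

lemma coeff_frac:
  "coeff z = (if frac (fst z) \<in> {hw<..<1 - hw} \<and> frac (snd z) \<in> {hw<..<1 - hw} then \<beta> else 1)"
proof -
  have "(1 - \<rho>) / 2 = hw" "(1 + \<rho>) / 2 = 1 - hw" by (simp_all add: hw_def field_simps)
  then show ?thesis unfolding coeff_fun_def by simp
qed

lemma coeff_eq: "coeff z = (if z \<in> solid then \<beta> else 1)"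
proof -
  have "z \<in> solid \<longleftrightarrow> frac (fst z) \<in> {hw<..<1 - hw} \<and> frac (snd z) \<in> {hw<..<1 - hw}"
    unfolding frac_mem_iff by (auto simp: mem_obst)
  then show ?thesis unfolding coeff_frac by auto
qed

lemma coeff_bounds: "1 \<le> coeff z" "coeff z \<le> \<beta>"
  using beta by (simp_all add: coeff_eq)

lemma coeff_nonneg: "0 \<le> coeff z"
  using coeff_bounds(1)[of z] by linarith

lemma coeff_strip: "z \<in> strip j \<Longrightarrow> coeff z = 1"
proof -
  assume z: "z \<in> strip j"
  have "z \<notin> obst i j'" for i j'
  proof
    assume a: "z \<in> obst i j'"
    then have "j' = j" using obst_col_row[OF a] strip_row[OF z] by simp
    then show False using a z by (simp add: mem_obst strip_def)
  qed
  then show ?thesis by (simp add: coeff_eq)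
qed

lemma coeff_column:
  assumes "fst z \<in> {real_of_int i + - hw..real_of_int i + hw}" shows "coeff z = 1"
proof -
  have "col z = i" using assms hw unfolding col_def by (auto intro!: floor_unique)
  have "z \<notin> obst i' j" for i' j
  proof
    assume a: "z \<in> obst i' j"
    then have "i' = i" using obst_col_row[OF a] \<open>col z = i\<close> by simp
    then show False using a assms by (simp add: mem_obst)
  qed
  then show ?thesis by (simp add: coeff_eq)
qed

lemma costs_nonneg: "r \<in> costs \<epsilon> \<xi> \<Longrightarrow> 0 \<le> r"
  by (auto simp: costs_def set_lebesgue_integral_def
      intro!: Bochner_Integration.integral_nonneg mult_nonneg_nonneg coeff_nonneg)

lemma scaled_dist_eq: "scaled_dist \<rho> \<beta> \<epsilon> \<xi> = Inf (costs \<epsilon> \<xi>)"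
  by (simp add: scaled_dist_def costs_def)

lemma polyline_costs:
  assumes \<epsilon>: "0 < \<epsilon>" and "polyline coeff z b"
  obtains r where "r \<in> costs \<epsilon> (\<epsilon> *\<^sub>R z)" "r \<le> \<epsilon> * b"
proof -
  obtain n P \<kappa> where P: "0 < n" "P 0 = 0" "P n = z"
      "\<And>i s. i < n \<Longrightarrow> s \<in> {0..1} \<Longrightarrow> coeff (P i + s *\<^sub>R (P (Suc i) - P i)) \<le> \<kappa> i"
      "b = (\<Sum>i<n. \<kappa> i * norm (P (Suc i) - P i))"
    using polyline_polygon[OF assms(2)] by blast
  have "\<exists>\<gamma> g. sobolev_path \<gamma> g \<and> \<gamma> 0 = 0 \<and> \<gamma> 1 = \<epsilon> *\<^sub>R P n \<and>
    (LINT t:{0<..<1}|lebesgue. coeff (\<gamma> t /\<^sub>R \<epsilon>) * norm (g t))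
      \<le> (\<Sum>i<n. \<kappa> i * norm (\<epsilon> *\<^sub>R P (Suc i) - \<epsilon> *\<^sub>R P i))"
  proof (rule polygon_cost[where P = "\<lambda>i. \<epsilon> *\<^sub>R P i" and a = "\<lambda>z. coeff (z /\<^sub>R \<epsilon>)"])
    show "coeff ((\<epsilon> *\<^sub>R P i + s *\<^sub>R (\<epsilon> *\<^sub>R P (Suc i) - \<epsilon> *\<^sub>R P i)) /\<^sub>R \<epsilon>) \<le> \<kappa> i"
      if "i < n" "s \<in> {0..1}" for i s
    proof -
      have "\<epsilon> *\<^sub>R P i + s *\<^sub>R (\<epsilon> *\<^sub>R P (Suc i) - \<epsilon> *\<^sub>R P i) =
          \<epsilon> *\<^sub>R (P i + s *\<^sub>R (P (Suc i) - P i))"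
        by (simp add: algebra_simps)
      then show ?thesis using P(4)[OF that] \<epsilon> by simp
    qed
    show "0 \<le> coeff (z /\<^sub>R \<epsilon>)" for z by (rule coeff_nonneg)
  qed (use P in auto)
  moreover have "(\<Sum>i<n. \<kappa> i * norm (\<epsilon> *\<^sub>R P (Suc i) - \<epsilon> *\<^sub>R P i)) = \<epsilon> * b"
    unfolding P(5) sum_distrib_left scaleR_diff_right[symmetric] using \<epsilon> by (intro sum.cong) auto
  ultimately show ?thesis using that P(3) unfolding costs_def by auto
qed

text \<open>The edge may cut through obstacles. The crude factor \<open>\<beta>\<close> suffices for
  the bounded first and last edges of a path.\<close>

lemma polyline_straight: "polyline coeff z b \<Longrightarrow> polyline coeff w (b + \<beta> * norm (w - z))"
  using step[of coeff z b "w - z" \<beta>] coeff_bounds(2) by simp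

lemma costs_nonempty:
  assumes "0 < \<epsilon>" shows "costs \<epsilon> \<xi> \<noteq> {}"
proof -
  have "\<epsilon> *\<^sub>R (\<xi> /\<^sub>R \<epsilon>) = \<xi>" using assms by simp
  then show ?thesis
    using polyline_costs[OF assms polyline_straight[OF start, of "\<xi> /\<^sub>R \<epsilon>"]] by fastforce
qed

lemma scaled_dist_le:
  assumes "0 < \<epsilon>" "polyline coeff (\<xi> /\<^sub>R \<epsilon>) b"
  shows "scaled_dist \<rho> \<beta> \<epsilon> \<xi> \<le> \<epsilon> * b"
proof -
  have "\<epsilon> *\<^sub>R (\<xi> /\<^sub>R \<epsilon>) = \<xi>" using assms by simp
  then obtain r where r: "r \<in> costs \<epsilon> \<xi>" "r \<le> \<epsilon> * b"
    using polyline_costs[OF assms] by metis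
  have "Inf (costs \<epsilon> \<xi>) \<le> r"
    using r(1) costs_nonneg by (intro cInf_lower bdd_belowI[of _ 0])
  then show ?thesis using r(2) by (simp add: scaled_dist_eq)
qed

text \<open>Division by \<open>\<epsilon>\<close> brings the path to the fixed obstacles of unit
  scale, where the calibration lives; the factor returns through the derivative.\<close>

lemma cost_ge:
  assumes \<epsilon>: "0 < \<epsilon>" and sp: "sobolev_path \<gamma> g" and ends: "\<gamma> 0 = 0" "\<gamma> 1 = \<xi>"
    and uQ: "\<And>i j z w. z \<in> closure (obst i j) \<Longrightarrow> w \<in> closure (obst i j) \<Longrightarrow> \<bar>u z - u w\<bar> \<le> \<beta> * dist z w"
    and uF: "\<And>z. z \<notin> solid \<Longrightarrow> \<exists>e>0. \<forall>w. dist w z < e \<and> w \<notin> solid \<longrightarrow> \<bar>u w - u z\<bar> \<le> dist w z"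
  shows "\<epsilon> * \<bar>u (\<xi> /\<^sub>R \<epsilon>) - u 0\<bar> \<le> (LINT t:{0<..<1}|lebesgue. coeff (\<gamma> t /\<^sub>R \<epsilon>) * norm (g t))"
proof -
  have cont: "continuous_on {0..1} \<gamma>" and g0: "g absolutely_integrable_on {0<..<1}"
    using sp by (auto simp: sobolev_path_def)
  let ?\<gamma> = "\<lambda>t. \<gamma> t /\<^sub>R \<epsilon>" and ?g = "\<lambda>t. g t /\<^sub>R \<epsilon>"
  have c\<gamma>: "continuous_on {0..1} ?\<gamma>" by (intro continuous_intros cont)
  have ng: "(\<lambda>t. norm (g t)) absolutely_integrable_on {0<..<1}"
    using absolutely_integrable_norm[OF g0] by (simp add: o_def)
  have "(\<lambda>t. coeff (?\<gamma> t)) \<in> borel_measurable (lebesgue_on {0<..<1})"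
  proof -
    \<comment> \<open>The coefficient along the path takes two values, and the set of times with the
      value \<open>\<beta>\<close> is open because the obstacles are.\<close>
    let ?T = "{0<..<1} \<inter> ?\<gamma> -` solid"
    have "open solid" using open_obst by blast
    moreover have "continuous_on {0<..<1} ?\<gamma>"
      by (rule continuous_on_subset[OF c\<gamma>]) auto
    ultimately have "open ?T" by (intro continuous_open_preimage open_greaterThanLessThan)
    then have T: "?T \<in> sets (lebesgue_on {0<..<1})"
      by (subst sets_restrict_space_iff) auto
    have "(\<lambda>t. if t \<in> ?T then \<beta> else 1) \<in> borel_measurable (lebesgue_on {0<..<1})"
      using T by (intro measurable_If_set) (auto simp: Int_absorb2)
    then show ?thesis
      by (rule measurable_cong[THEN iffD1, rotated]) (auto simp: coeff_eq)
  qed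
  then have f: "(\<lambda>t. coeff (?\<gamma> t) * norm (g t)) absolutely_integrable_on {0<..<1}"
  proof (rule absolutely_integrable_bounded_measurable_product_real)
    have "norm (coeff z) \<le> \<beta>" for z
      using coeff_nonneg[of z] coeff_bounds(2)[of z] by simp
    then show "bounded ((\<lambda>t. coeff (?\<gamma> t)) ` {0<..<1})"
      unfolding bounded_iff by blast
  qed (use ng in auto)
  have int01: "h integrable_on {0..1}" if "h absolutely_integrable_on {0<..<1}" for h :: "real \<Rightarrow> real"
    using that set_lebesgue_integral_eq_integral(1) integrable_on_Icc_iff_Ioo by blast
  have "\<bar>u (?\<gamma> 1) - u (?\<gamma> 0)\<bar> \<le> integral {0..1} (\<lambda>t. coeff (?\<gamma> t) * norm (?g t))"
  proof (rule calibration_le_cost[where \<Q> = "range (\<lambda>(i, j). obst i j)" and \<beta> = \<beta>])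
    show "(?g has_integral ?\<gamma> t - ?\<gamma> s) {s..t}" if "0 \<le> s" "s \<le> t" "t \<le> 1" for s t
      using has_integral_cmul[OF sobolev_path_has_integral[OF sp that], of "inverse \<epsilon>"]
      by (simp add: scaleR_diff_right)
    show "(\<lambda>t. norm (?g t)) integrable_on {0..1}"
      using integrable_on_cmult_left[OF int01[OF ng], of "inverse \<epsilon>"] \<epsilon> by simp
    show "(\<lambda>t. coeff (?\<gamma> t) * norm (?g t)) integrable_on {0..1}"
      using integrable_on_cmult_left[OF int01[OF f], of "inverse \<epsilon>"] \<epsilon> by (simp add: mult.left_commute)
    show "1 \<le> coeff z" for z by (rule coeff_bounds)
    show "coeff z = \<beta>" if "z \<in> \<Union> (range (\<lambda>(i, j). obst i j))" for z
      using that by (auto simp: coeff_eq)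
    show "frontier Q \<inter> \<Union> (range (\<lambda>(i, j). obst i j)) = {}" if "Q \<in> range (\<lambda>(i, j). obst i j)" for Q
      using that frontier_obst_disjoint open_obst by (fastforce simp: frontier_def interior_open)
    show "\<exists>e>0. \<forall>w. dist w z < e \<and> w \<notin> \<Union> (range (\<lambda>(i, j). obst i j)) \<longrightarrow> \<bar>u w - u z\<bar> \<le> dist w z"
      if "z \<notin> \<Union> (range (\<lambda>(i, j). obst i j))" for z
    proof -
      have eq: "\<Union> (range (\<lambda>(i, j). obst i j)) = solid" by auto
      show ?thesis using uF[of z] that unfolding eq by blast
    qed
  qed (use c\<gamma> beta open_obst uQ in auto)
  also have "integral {0..1} (\<lambda>t. coeff (?\<gamma> t) * norm (?g t)) =
      inverse \<epsilon> * integral {0..1} (\<lambda>t. coeff (?\<gamma> t) * norm (g t))"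
    using \<epsilon> by (simp add: mult.left_commute integral_mult_right[symmetric] del: integral_mult_right)
  also have "integral {0..1} (\<lambda>t. coeff (?\<gamma> t) * norm (g t)) =
      (LINT t:{0<..<1}|lebesgue. coeff (\<gamma> t /\<^sub>R \<epsilon>) * norm (g t))"
    using set_lebesgue_integral_eq_integral(2)[OF f] by (simp add: integral_open_interval_real)
  finally show ?thesis using ends \<epsilon> by (simp add: field_simps)
qed

lemma scaled_dist_ge:
  assumes \<epsilon>: "0 < \<epsilon>"
    and uQ: "\<And>i j z w. z \<in> closure (obst i j) \<Longrightarrow> w \<in> closure (obst i j) \<Longrightarrow> \<bar>u z - u w\<bar> \<le> \<beta> * dist z w"
    and uF: "\<And>z. z \<notin> solid \<Longrightarrow> \<exists>e>0. \<forall>w. dist w z < e \<and> w \<notin> solid \<longrightarrow> \<bar>u w - u z\<bar> \<le> dist w z"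
  shows "\<epsilon> * \<bar>u (\<xi> /\<^sub>R \<epsilon>) - u 0\<bar> \<le> scaled_dist \<rho> \<beta> \<epsilon> \<xi>"
  unfolding scaled_dist_eq
proof (rule cInf_greatest[OF costs_nonempty[OF \<epsilon>]])
  fix r assume "r \<in> costs \<epsilon> \<xi>"
  then obtain \<gamma> g where \<gamma>: "sobolev_path \<gamma> g" "\<gamma> 0 = 0" "\<gamma> 1 = \<xi>"
    and r: "r = (LINT t:{0<..<1}|lebesgue. coeff (\<gamma> t /\<^sub>R \<epsilon>) * norm (g t))"
    unfolding costs_def by blast
  show "\<epsilon> * \<bar>u (\<xi> /\<^sub>R \<epsilon>) - u 0\<bar> \<le> r"
    unfolding r by (rule cost_ge[OF \<epsilon> \<gamma>]) (fact uQ, fact uF)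
qed

end

text \<open>Meant for the symmetries of the obstacle pattern: a bounded linear map commutes with
  both integrals of the weak formulation.\<close>

lemma sobolev_path_linear_image:
  assumes sp: "sobolev_path \<gamma> g" and T: "bounded_linear T"
  shows "sobolev_path (\<lambda>t. T (\<gamma> t)) (\<lambda>t. T (g t))"
  unfolding sobolev_path_def
proof (intro conjI allI impI)
  have cont: "continuous_on {0..1} \<gamma>" and g: "g absolutely_integrable_on {0<..<1}"
    using sp by (auto simp: sobolev_path_def)
  show "continuous_on {0..1} (\<lambda>t. T (\<gamma> t))"
    by (rule bounded_linear.continuous_on[OF T cont])
  show "(\<lambda>t. T (g t)) absolutely_integrable_on {0<..<1}"
    using absolutely_integrable_linear[OF g T] by (simp add: o_def)
  fix \<phi> \<phi>' :: "real \<Rightarrow> real"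
  assume t: "test_fun \<phi> \<phi>'"
  have c\<phi>: "continuous_on {0..1} \<phi>"
    using t DERIV_isCont continuous_at_imp_continuous_on unfolding test_fun_def by blast
  have c\<phi>': "continuous_on {0..1} \<phi>'"
    using t continuous_on_subset by (auto simp: test_fun_def)
  have "(\<lambda>x. \<phi>' x *\<^sub>R \<gamma> x) absolutely_integrable_on {0<..<1}"
    by (rule set_integrable_subset[OF absolutely_integrable_continuous_real])
       (auto intro!: continuous_intros c\<phi>' cont)
  then have i1: "integrable lebesgue (\<lambda>x. indicator {0<..<1} x *\<^sub>R \<phi>' x *\<^sub>R \<gamma> x)"
    by (simp add: set_integrable_def)
  have i2: "integrable lebesgue (\<lambda>x. indicator {0<..<1} x *\<^sub>R \<phi> x *\<^sub>R g x)"
    using absolutely_integrable_continuous_scaleR[OF c\<phi> g] by (simp add: set_integrable_def)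
  have lin: "T (r *\<^sub>R z) = r *\<^sub>R T z" "T (- z) = - T z" for r z
    using bounded_linear.linear[OF T] by (simp_all add: linear_cmul linear_neg)
  have "(LINT t:{0<..<1}|lebesgue. \<phi>' t *\<^sub>R T (\<gamma> t)) = T (LINT t:{0<..<1}|lebesgue. \<phi>' t *\<^sub>R \<gamma> t)"
    unfolding set_lebesgue_integral_def integral_bounded_linear[OF T i1, symmetric] by (simp only: lin)
  also have "\<dots> = - T (LINT t:{0<..<1}|lebesgue. \<phi> t *\<^sub>R g t)"
    using sp t by (simp add: sobolev_path_def lin)
  also have "T (LINT t:{0<..<1}|lebesgue. \<phi> t *\<^sub>R g t) = (LINT t:{0<..<1}|lebesgue. \<phi> t *\<^sub>R T (g t))"
    unfolding set_lebesgue_integral_def integral_bounded_linear[OF T i2, symmetric] by (simp only: lin)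
  finally show "(LINT t:{0<..<1}|lebesgue. \<phi>' t *\<^sub>R T (\<gamma> t)) = - (LINT t:{0<..<1}|lebesgue. \<phi> t *\<^sub>R T (g t))" .
qed

section \<open>Upper bounds from periodic paths, values of the limit, and symmetries\<close>

context obstacles
begin

lemma polyline_free:
  assumes "polyline coeff z b" and "\<And>s. s \<in> {0..1} \<Longrightarrow> coeff (z + s *\<^sub>R v) = 1"
  shows "polyline coeff (z + v) (b + norm v)"
  using step[OF assms(1), of v 1] assms(2) by simp

lemma between_scaled:
  fixes l m x d s :: real
  assumes "x \<in> {l..m}" "x + d \<in> {l..m}" "s \<in> {0..1}"
  shows "x + s * d \<in> {l..m}"
proof -
  have "x + s * d = (1 - s) * x + s * (x + d)" by (simp add: algebra_simps)
  moreover have "(1 - s) * x + s * (x + d) \<in> {l..m}"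
    using convexD_alt[OF convex_real_interval(5)[of l m] assms(1,2), of s] assms(3) by simp
  ultimately show ?thesis by simp
qed

lemma polyline_strip:
  assumes "polyline coeff z b" "z \<in> strip j" "z + v \<in> strip j"
  shows "polyline coeff (z + v) (b + norm v)"
proof (rule polyline_free[OF assms(1)])
  fix s :: real assume "s \<in> {0..1}"
  then have "z + s *\<^sub>R v \<in> strip j"
    using between_scaled[of "snd z" "real_of_int j + - hw" "real_of_int j + hw" "snd v" s] assms(2,3)
    by (simp add: strip_def)
  then show "coeff (z + s *\<^sub>R v) = 1" by (rule coeff_strip)
qed

lemma polyline_column:
  assumes "polyline coeff z b" "fst z \<in> {real_of_int i + - hw..real_of_int i + hw}"
    "fst (z + v) \<in> {real_of_int i + - hw..real_of_int i + hw}"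
  shows "polyline coeff (z + v) (b + norm v)"
proof (rule polyline_free[OF assms(1)])
  fix s :: real assume "s \<in> {0..1}"
  then have "fst (z + s *\<^sub>R v) \<in> {real_of_int i + - hw..real_of_int i + hw}"
    using between_scaled[of "fst z" "real_of_int i + - hw" "real_of_int i + hw" "fst v" s] assms(2,3)
    by simp
  then show "coeff (z + s *\<^sub>R v) = 1" by (rule coeff_column)
qed

text \<open>From the upper left corner of one obstacle the path crosses the strip to the lower right
  corner of the obstacle one row up and \<open>k\<close> columns to the right. It then crosses the
  vertical channel to the upper left corner of the next obstacle in that row.\<close>

lemma polyline_period:
  fixes i j :: int
  assumes "polyline coeff (real_of_int i + hw, real_of_int j - hw) b"
  shows "polyline coeff (real_of_int (i + int k + 1) + hw, real_of_int (j + 1) - hw) (b + c k)"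
proof -
  let ?v = "(real k + \<rho>, gap)" and ?w = "(gap, \<rho>)"
  have "(real_of_int i + hw, real_of_int j - hw) \<in> strip j"
    "(real_of_int i + hw, real_of_int j - hw) + ?v \<in> strip j"
    using hw by (simp_all add: strip_def)
  from polyline_strip[OF assms this]
  have 1: "polyline coeff ((real_of_int i + hw, real_of_int j - hw) + ?v) (b + f (real k + \<rho>))"
    by (simp add: norm_Pair hyp_def)
  have "fst ((real_of_int i + hw, real_of_int j - hw) + ?v) \<in>
      {real_of_int (i + int k + 1) + - hw..real_of_int (i + int k + 1) + hw}"
    "fst ((real_of_int i + hw, real_of_int j - hw) + ?v + ?w) \<in>
      {real_of_int (i + int k + 1) + - hw..real_of_int (i + int k + 1) + hw}"
    using hw by simp_all
  from polyline_column[OF 1 this]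
  have 2: "polyline coeff ((real_of_int i + hw, real_of_int j - hw) + ?v + ?w) (b + f (real k + \<rho>) + L)"
    by (simp add: norm_Pair hyp_def L_def add.commute)
  have eq: "(real_of_int i + hw, real_of_int j - hw) + ?v + ?w =
      (real_of_int (i + int k + 1) + hw, real_of_int (j + 1) - hw)"
    using hw by simp
  show ?thesis using 2 unfolding eq by (simp only: c_def add.assoc)
qed

lemma polyline_periods:
  fixes i j :: int
  assumes "polyline coeff (real_of_int i + hw, real_of_int j - hw) b"
  shows "polyline coeff (real_of_int (i + int n * (int k + 1)) + hw, real_of_int (j + int n) - hw)
    (b + real n * c k)"
proof (induction n)
  case 0
  then show ?case using assms by simp
next
  case (Suc n)
  from polyline_period[OF this, of k] show ?case by (simp add: algebra_simps)
qed

text \<open>The coefficients on the right are the coordinates of \<open>(x, y)\<close> in the basis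
  \<open>(k + 1, 1)\<close>, \<open>(k + 2, 1)\<close>, where the linear function takes the values
  \<open>c k\<close> and \<open>c (Suc k)\<close>.\<close>

lemma cone_value:
  "p k * x + q k * y = ((real k + 2) * y - x) * c k + (x - (real k + 1) * y) * c (Suc k)"
  unfolding q_def p_eq by (simp add: algebra_simps)

text \<open>The integer parts of the cone coordinates count whole periods of the two optimal paths.
  Straight edges at both ends add a cost that does not depend on the point.\<close>

lemma polyline_cone:
  assumes "(real k + 1) * y \<le> x" "x \<le> (real k + 2) * y"
  shows "\<exists>b \<le> p k * x + q k * y + \<beta> * (2 * real k + 8). polyline coeff (x, y) b"
proof -
  define \<mu> \<nu> where "\<mu> = (real k + 2) * y - x" and "\<nu> = x - (real k + 1) * y"
  have nonneg: "0 \<le> \<mu>" "0 \<le> \<nu>" using assms by (auto simp: \<mu>_def \<nu>_def)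
  define m n where "m = nat \<lfloor>\<mu>\<rfloor>" and "n = nat \<lfloor>\<nu>\<rfloor>"
  have m: "real m \<le> \<mu>" "\<mu> < real m + 1" and n: "real n \<le> \<nu>" "\<nu> < real n + 1"
    using nonneg by (auto simp: m_def n_def)
  have x: "x = \<mu> * (real k + 1) + \<nu> * (real k + 2)" and y: "y = \<mu> + \<nu>"
    by (auto simp: \<mu>_def \<nu>_def algebra_simps)
  have pq: "p k * x + q k * y = \<mu> * c k + \<nu> * c (Suc k)"
    by (simp add: cone_value \<mu>_def \<nu>_def)
  let ?A = "(hw, - hw)"
  have nA: "norm ?A \<le> 1"
    using norm_Pair_le[of hw "- hw"] hw by simp
  have "polyline coeff ?A (\<beta> * norm ?A)" using polyline_straight[OF start, of ?A] by simp
  then have "polyline coeff (real_of_int 0 + hw, real_of_int 0 - hw) (\<beta> * norm ?A)" by simp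
  from polyline_periods[OF polyline_periods[OF this, of m k], of n "Suc k"]
  have "polyline coeff (real m * (real k + 1) + real n * (real k + 2) + hw, real m + real n - hw)
      (\<beta> * norm ?A + real m * c k + real n * c (Suc k))" (is "polyline _ ?E _")
    by (simp add: algebra_simps)
  from polyline_straight[OF this, of "(x, y)"]
  have P: "polyline coeff (x, y)
    (\<beta> * norm ?A + real m * c k + real n * c (Suc k) + \<beta> * norm ((x, y) - ?E))" .
  \<comment> \<open>Horizontally the fractional parts give at most \<open>2 * k + 3\<close> and
    \<open>hw\<close> less than 1, vertically the difference is at most 3. With the first edge, of
    length at most 1, this makes \<open>2 * k + 8\<close>.\<close>
  have "norm ((x, y) - ?E) \<le> 2 * real k + 7"
  proof -
    have "(\<mu> - real m) * (real k + 1) \<le> real k + 1" "(\<nu> - real n) * (real k + 2) \<le> real k + 2"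
      using m n by (auto intro!: mult_left_le_one_le)
    moreover have "0 \<le> (\<mu> - real m) * (real k + 1)" "0 \<le> (\<nu> - real n) * (real k + 2)"
      using m n by (auto intro!: mult_nonneg_nonneg)
    moreover have "x - fst ?E = (\<mu> - real m) * (real k + 1) + (\<nu> - real n) * (real k + 2) - hw"
      by (simp add: x algebra_simps)
    ultimately have "\<bar>x - fst ?E\<bar> \<le> 2 * real k + 4" using hw by linarith
    moreover have "\<bar>y - snd ?E\<bar> \<le> 3" using m n hw by (simp add: y abs_le_iff)
    ultimately show ?thesis
      using norm_Pair_le[of "x - fst ?E" "y - snd ?E"] by simp
  qed
  then have "\<beta> * (norm ?A + norm ((x, y) - ?E)) \<le> \<beta> * (2 * real k + 8)"
    using nA beta by (intro mult_left_mono) auto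
  moreover have "real m * c k + real n * c (Suc k) \<le> p k * x + q k * y"
  proof -
    have "0 \<le> c l" for l using hyp_ge(3)[of gap] by (simp add: c_def L_def)
    then show ?thesis unfolding pq using m n by (intro add_mono mult_right_mono) auto
  qed
  ultimately show ?thesis
    by (intro exI[of _ "\<beta> * norm ?A + real m * c k + real n * c (Suc k) + \<beta> * norm ((x, y) - ?E)"] conjI P)
       (simp add: distrib_left)
qed

text \<open>A \<open>Lim\<close> is informative only once convergence is known; two-sided bounds
  with an error proportional to \<open>\<epsilon>\<close> give convergence and value
  together.\<close>

lemma limit_metric_eqI:
  assumes "\<And>\<epsilon>. 0 < \<epsilon> \<Longrightarrow> r - \<epsilon> * B \<le> scaled_dist \<rho> \<beta> \<epsilon> \<xi>"
    and "\<And>\<epsilon>. 0 < \<epsilon> \<Longrightarrow> scaled_dist \<rho> \<beta> \<epsilon> \<xi> \<le> r + \<epsilon> * B"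
  shows "limit_metric \<rho> \<beta> \<xi> = r"
proof -
  have lim: "((\<lambda>\<epsilon>. r - \<epsilon> * B) \<longlongrightarrow> r - 0 * B) (at_right 0)"
    "((\<lambda>\<epsilon>. r + \<epsilon> * B) \<longlongrightarrow> r + 0 * B) (at_right 0)"
    by (intro tendsto_intros)+
  have "((\<lambda>\<epsilon>. scaled_dist \<rho> \<beta> \<epsilon> \<xi>) \<longlongrightarrow> r) (at_right 0)"
  proof (rule tendsto_sandwich)
    show "\<forall>\<^sub>F \<epsilon> in at_right 0. r - \<epsilon> * B \<le> scaled_dist \<rho> \<beta> \<epsilon> \<xi>"
      by (rule eventually_mono[OF eventually_at_right_less assms(1)])
    show "\<forall>\<^sub>F \<epsilon> in at_right 0. scaled_dist \<rho> \<beta> \<epsilon> \<xi> \<le> r + \<epsilon> * B"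
      by (rule eventually_mono[OF eventually_at_right_less assms(2)])
    show "((\<lambda>\<epsilon>. r - \<epsilon> * B) \<longlongrightarrow> r) (at_right 0)" using lim(1) by simp
    show "((\<lambda>\<epsilon>. r + \<epsilon> * B) \<longlongrightarrow> r) (at_right 0)" using lim(2) by simp
  qed
  then show ?thesis
    unfolding limit_metric_def by (intro tendsto_Lim) simp_all
qed

lemma limit_metric_cone:
  assumes "(real k + 1) * y \<le> x" "x \<le> (real k + 2) * y"
  shows "limit_metric \<rho> \<beta> (x, y) = p k * x + q k * y"
proof -
  obtain u C where uQ: "\<And>i j z w. z \<in> closure (obst i j) \<Longrightarrow> w \<in> closure (obst i j) \<Longrightarrow> \<bar>u z - u w\<bar> \<le> \<beta> * dist z w"
    and uF: "\<And>z. z \<notin> solid \<Longrightarrow> \<exists>e>0. \<forall>w. dist w z < e \<and> w \<notin> solid \<longrightarrow> \<bar>u w - u z\<bar> \<le> dist w z"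
    and uC: "\<And>z. \<bar>u z - (p k * fst z + q k * snd z)\<bar> \<le> C"
    using calibration_exists[of k] by metis
  let ?D = "\<beta> * (2 * real k + 8)"
  have "0 \<le> C" using uC[of 0] abs_ge_zero order_trans by blast
  have "0 \<le> ?D" using beta by simp
  show ?thesis
  \<comment> \<open>The lower bound loses \<open>C\<close> at each end of the path, the upper bound
    loses \<open>?D\<close>; one constant serves for both.\<close>
  proof (rule limit_metric_eqI[where B = "2 * C + ?D"])
    fix \<epsilon> :: real assume \<epsilon>: "0 < \<epsilon>"
    have "p k * (x / \<epsilon>) + q k * (y / \<epsilon>) - 2 * C \<le> \<bar>u ((x, y) /\<^sub>R \<epsilon>) - u 0\<bar>"
      using uC[of "(x, y) /\<^sub>R \<epsilon>"] uC[of 0] by (simp add: divide_inverse mult.commute)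
    then have "\<epsilon> * (p k * (x / \<epsilon>) + q k * (y / \<epsilon>) - 2 * C) \<le> \<epsilon> * \<bar>u ((x, y) /\<^sub>R \<epsilon>) - u 0\<bar>"
      using \<epsilon> by (intro mult_left_mono) auto
    also have "\<dots> \<le> scaled_dist \<rho> \<beta> \<epsilon> (x, y)"
      by (rule scaled_dist_ge[OF \<epsilon>]) (fact uQ, fact uF)
    finally have "p k * x + q k * y - \<epsilon> * (2 * C) \<le> scaled_dist \<rho> \<beta> \<epsilon> (x, y)"
      using \<epsilon> by (simp add: algebra_simps)
    then show "p k * x + q k * y - \<epsilon> * (2 * C + ?D) \<le> scaled_dist \<rho> \<beta> \<epsilon> (x, y)"
      using mult_nonneg_nonneg[OF less_imp_le[OF \<epsilon>] \<open>0 \<le> ?D\<close>] unfolding distrib_left by linarith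
    have "(real k + 1) * (y / \<epsilon>) \<le> x / \<epsilon>" "x / \<epsilon> \<le> (real k + 2) * (y / \<epsilon>)"
      using assms \<epsilon> by (simp_all add: divide_right_mono)
    from polyline_cone[OF this] obtain b where b: "b \<le> p k * (x / \<epsilon>) + q k * (y / \<epsilon>) + ?D"
      "polyline coeff (x / \<epsilon>, y / \<epsilon>) b" by blast
    have "polyline coeff ((x, y) /\<^sub>R \<epsilon>) b"
      using b(2) by (simp add: divide_inverse mult.commute)
    then have "scaled_dist \<rho> \<beta> \<epsilon> (x, y) \<le> \<epsilon> * b" by (rule scaled_dist_le[OF \<epsilon>])
    also have "\<dots> \<le> \<epsilon> * (p k * (x / \<epsilon>) + q k * (y / \<epsilon>) + ?D)"
      using b(1) \<epsilon> by (intro mult_left_mono) auto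
    also have "\<dots> = p k * x + q k * y + \<epsilon> * ?D"
      using \<epsilon> by (simp add: distrib_left)
    finally show "scaled_dist \<rho> \<beta> \<epsilon> (x, y) \<le> p k * x + q k * y + \<epsilon> * (2 * C + ?D)"
      using mult_nonneg_nonneg[OF less_imp_le[OF \<epsilon>] \<open>0 \<le> C\<close>] unfolding distrib_left by linarith
  qed
qed

text \<open>The cones meet the axis only at the origin. Here the first coordinate is itself a
  calibration and the axis runs inside a strip, so the value is exact at every scale.\<close>

lemma limit_metric_axis: "limit_metric \<rho> \<beta> (x, 0) = \<bar>x\<bar>"
proof (rule limit_metric_eqI[where B = 0])
  fix \<epsilon> :: real assume \<epsilon>: "0 < \<epsilon>"
  have "\<epsilon> * \<bar>fst ((x, 0 :: real) /\<^sub>R \<epsilon>) - fst (0 :: real \<times> real)\<bar> \<le> scaled_dist \<rho> \<beta> \<epsilon> (x, 0)"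
  proof (rule scaled_dist_ge[where u = fst and \<xi> = "(x, 0)", OF \<epsilon>])
    show "\<bar>fst z - fst w\<bar> \<le> \<beta> * dist z w" for z w :: "real \<times> real"
      using dist_prod_bounds(1)[of z w] mult_right_mono[of 1 \<beta> "dist z w"] beta by simp
    show "\<exists>e>0. \<forall>w. dist w z < e \<and> w \<notin> solid \<longrightarrow> \<bar>fst w - fst z\<bar> \<le> dist w z" for z
      using dist_prod_bounds(1) zero_less_one by blast
  qed
  then show "\<bar>x\<bar> - \<epsilon> * 0 \<le> scaled_dist \<rho> \<beta> \<epsilon> (x, 0)"
    using \<epsilon> by (simp add: abs_mult mult.assoc[symmetric])
  have "polyline coeff (0 + (x, 0) /\<^sub>R \<epsilon>) (0 + norm ((x, 0 :: real) /\<^sub>R \<epsilon>))"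
    by (rule polyline_strip[OF start, where j = 0]) (use hw in \<open>auto simp: strip_def\<close>)
  then have "polyline coeff ((x, 0) /\<^sub>R \<epsilon>) (norm ((x, 0 :: real) /\<^sub>R \<epsilon>))" by simp
  then have "scaled_dist \<rho> \<beta> \<epsilon> (x, 0) \<le> \<epsilon> * norm ((x, 0 :: real) /\<^sub>R \<epsilon>)"
    by (rule scaled_dist_le[OF \<epsilon>])
  then show "scaled_dist \<rho> \<beta> \<epsilon> (x, 0) \<le> \<bar>x\<bar> + \<epsilon> * 0"
    using \<epsilon> by (simp add: norm_Pair abs_mult mult.assoc[symmetric])
qed

text \<open>Since \<open>T\<close> is an involution, one inclusion between the sets of costs yields
  the other.\<close>

lemma limit_metric_symmetry:
  assumes T: "bounded_linear T" and norm: "\<And>z. norm (T z) = norm z" and inv: "\<And>z. T (T z) = z"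
    and coeff: "\<And>z. coeff (T z) = coeff z"
  shows "limit_metric \<rho> \<beta> (T \<xi>) = limit_metric \<rho> \<beta> \<xi>"
proof -
  have sub: "costs \<epsilon> \<xi> \<subseteq> costs \<epsilon> (T \<xi>)" for \<epsilon> \<xi>
  proof
    fix r assume "r \<in> costs \<epsilon> \<xi>"
    then obtain \<gamma> g where \<gamma>: "sobolev_path \<gamma> g" "\<gamma> 0 = 0" "\<gamma> 1 = \<xi>"
      and r: "r = (LINT t:{0<..<1}|lebesgue. coeff (\<gamma> t /\<^sub>R \<epsilon>) * norm (g t))"
      unfolding costs_def by blast
    have "T z /\<^sub>R \<epsilon> = T (z /\<^sub>R \<epsilon>)" for z
      using bounded_linear.linear[OF T] by (simp add: linear_cmul)
    then have "r = (LINT t:{0<..<1}|lebesgue. coeff (T (\<gamma> t) /\<^sub>R \<epsilon>) * norm (T (g t)))"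
      using r by (simp add: coeff norm)
    moreover have "T (\<gamma> 0) = 0" "T (\<gamma> 1) = T \<xi>"
      using \<gamma> bounded_linear.linear[OF T] by (simp_all add: linear_0)
    ultimately show "r \<in> costs \<epsilon> (T \<xi>)"
      unfolding costs_def using sobolev_path_linear_image[OF \<gamma>(1) T]
      by (intro CollectI exI[of _ "\<lambda>t. T (\<gamma> t)"] exI[of _ "\<lambda>t. T (g t)"] conjI)
  qed
  have "costs \<epsilon> (T \<xi>) = costs \<epsilon> \<xi>" for \<epsilon>
    using sub[of \<epsilon> \<xi>] sub[of \<epsilon> "T \<xi>"] by (simp add: inv)
  then show ?thesis by (simp add: limit_metric_def scaled_dist_eq)
qed

lemma frac_minus_mem_iff: "frac (- x) \<in> {hw<..<1 - hw} \<longleftrightarrow> frac x \<in> {hw<..<1 - hw}"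
proof (cases "x \<in> \<int>")
  \<comment> \<open>At integers the rule \<open>frac (- x) = 1 - frac x\<close> fails, but both
    fractional parts are 0.\<close>
  case True
  then have "frac x = 0" "frac (- x) = 0" by (simp_all add: frac_eq_0_iff)
  then show ?thesis by (simp only:)
next
  case False
  then have "frac (- x) = 1 - frac x" by (simp add: frac_neg)
  then show ?thesis by auto
qed

lemma limit_metric_reflect:
  "limit_metric \<rho> \<beta> (- x, y) = limit_metric \<rho> \<beta> (x, y)"
  "limit_metric \<rho> \<beta> (x, - y) = limit_metric \<rho> \<beta> (x, y)"
  "limit_metric \<rho> \<beta> (y, x) = limit_metric \<rho> \<beta> (x, y)"
proof -
  have bl: "bounded_linear (\<lambda>z. (- fst z, snd z :: real) :: real \<times> real)"
    "bounded_linear (\<lambda>z. (fst z, - snd z :: real) :: real \<times> real)"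
    "bounded_linear (\<lambda>z. (snd z, fst z) :: real \<times> real)"
    by (intro bounded_linear_Pair bounded_linear_minus bounded_linear_fst bounded_linear_snd)+
  have coeffs: "coeff (- fst z, snd z) = coeff z" "coeff (fst z, - snd z) = coeff z"
    "coeff (snd z, fst z) = coeff z" for z
    unfolding coeff_frac fst_conv snd_conv frac_minus_mem_iff by (auto simp only: conj_commute)
  have norms: "norm (- fst z, snd z) = norm z" "norm (fst z, - snd z) = norm z"
    "norm (snd z, fst z) = norm z" for z :: "real \<times> real"
    by (simp_all add: norm_prod_def add.commute)
  show "limit_metric \<rho> \<beta> (- x, y) = limit_metric \<rho> \<beta> (x, y)"
    using limit_metric_symmetry[OF bl(1) norms(1) _ coeffs(1), of "(x, y)"] by simp
  show "limit_metric \<rho> \<beta> (x, - y) = limit_metric \<rho> \<beta> (x, y)"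
    using limit_metric_symmetry[OF bl(2) norms(2) _ coeffs(2), of "(x, y)"] by simp
  show "limit_metric \<rho> \<beta> (y, x) = limit_metric \<rho> \<beta> (x, y)"
    using limit_metric_symmetry[OF bl(3) norms(3) _ coeffs(3), of "(x, y)"] by simp
qed

end

section \<open>Kinks and affine pieces\<close>

text \<open>A derivative along \<open>v\<close> would have to be at least \<open>a\<close> and at
  most \<open>b\<close>. One-sided lower bounds suffice for this, which matters at the axis, where
  the cones accumulate and no affine formula holds on a neighbourhood.\<close>

lemma not_differentiable_kink:
  fixes F :: "real \<times> real \<Rightarrow> real"
  assumes "0 < e" "b < a"
    and right: "\<And>t. 0 < t \<Longrightarrow> t < e \<Longrightarrow> F z + a * t \<le> F (z + t *\<^sub>R v)"
    and left: "\<And>t. - e < t \<Longrightarrow> t < 0 \<Longrightarrow> F z + b * t \<le> F (z + t *\<^sub>R v)"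
  shows "\<not> F differentiable (at z)"
proof
  assume "F differentiable (at z)"
  then obtain F' where F': "(F has_derivative F') (at z)" by (auto simp: differentiable_def)
  have lin: "((\<lambda>t. z + t *\<^sub>R v) has_derivative (\<lambda>t. t *\<^sub>R v)) (at 0)"
    by (auto intro!: derivative_eq_intros)
  have "((\<lambda>t. F (z + t *\<^sub>R v)) has_derivative (\<lambda>t. F' (t *\<^sub>R v))) (at 0)"
    by (rule has_derivative_compose[OF lin]) (use F' in simp)
  moreover have "F' (t *\<^sub>R v) = F' v * t" for t
    using has_derivative_linear[OF F'] by (simp add: linear_cmul)
  ultimately have D: "((\<lambda>t. F (z + t *\<^sub>R v)) has_real_derivative F' v) (at 0)"
    by (simp add: has_field_derivative_def)
  have G: "((\<lambda>t. F (z + t *\<^sub>R v) - F z - r * t) has_real_derivative F' v - r) (at 0)" for r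
    by (rule derivative_eq_intros D refl | simp)+
  consider "F' v - a < 0" | "0 < F' v - b" using \<open>b < a\<close> by linarith
  then show False
  proof cases
    case 1
    from DERIV_neg_dec_right[OF G 1] obtain d where d: "0 < d"
      "\<And>h. 0 < h \<Longrightarrow> h < d \<Longrightarrow> F (z + h *\<^sub>R v) - F z - a * h < 0" by auto
    obtain m where "0 < m" "m < d" "m < e"
      using field_lbound_gt_zero[OF d(1) \<open>0 < e\<close>] by blast
    then show False using right[of m] d(2)[of m] by simp
  next
    case 2
    from DERIV_pos_inc_left[OF G 2] obtain d where d: "0 < d"
      "\<And>h. 0 < h \<Longrightarrow> h < d \<Longrightarrow> F (z + (- h) *\<^sub>R v) - F z - b * (- h) < 0" by auto
    obtain m where "0 < m" "m < d" "m < e"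
      using field_lbound_gt_zero[OF d(1) \<open>0 < e\<close>] by blast
    then show False using left[of "- m"] d(2)[of m] by simp
  qed
qed

context obstacles
begin

abbreviation psi :: "real \<times> real \<Rightarrow> real" where "psi \<equiv> limit_metric \<rho> \<beta>"

text \<open>On a horizontal line the point separates the cones \<open>k - 1\<close> and
  \<open>k\<close>, with slopes \<open>p (k - 1)\<close> and \<open>p k\<close>; moves shorter than
  \<open>y\<close> stay in these cones. For \<open>k = 0\<close> the line would be the diagonal,
  whose other side is reached by a symmetry instead.\<close>

lemma kink_line:
  assumes "1 \<le> k" "0 < x"
  shows "\<not> psi differentiable (at (x, x / (real k + 1)))"
proof -
  define y where "y = x / (real k + 1)"
  have y: "0 < y" "x = (real k + 1) * y" using assms by (auto simp: y_def)
  have "\<not> psi differentiable (at (x, y))"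
  proof (rule not_differentiable_kink[where v = "(1, 0)" and a = "p k" and b = "p (k - 1)"])
    show "0 < y" by fact
    show "p (k - 1) < p k" using p_strict_mono[of "k - 1"] assms by simp
    fix t :: real
    show "psi (x, y) + p k * t \<le> psi ((x, y) + t *\<^sub>R (1, 0))"
      if "0 < t" "t < y"
    proof -
      have "(real k + 1) * y \<le> x" "x \<le> (real k + 2) * y"
        "(real k + 1) * y \<le> x + t" "x + t \<le> (real k + 2) * y"
        using y that by (simp_all add: algebra_simps)
      then have "psi (x, y) = p k * x + q k * y" "psi (x + t, y) = p k * (x + t) + q k * y"
        by (auto intro: limit_metric_cone)
      then show ?thesis by (simp add: algebra_simps)
    qed
    show "psi (x, y) + p (k - 1) * t \<le> psi ((x, y) + t *\<^sub>R (1, 0))"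
      if "- y < t" "t < 0"
    proof -
      have "(real (k - 1) + 1) * y \<le> x" "x \<le> (real (k - 1) + 2) * y"
        "(real (k - 1) + 1) * y \<le> x + t" "x + t \<le> (real (k - 1) + 2) * y"
        using y that assms(1) by (simp_all add: of_nat_diff algebra_simps)
      then have "psi (x, y) = p (k - 1) * x + q (k - 1) * y"
        "psi (x + t, y) = p (k - 1) * (x + t) + q (k - 1) * y"
        by (auto intro: limit_metric_cone)
      then show ?thesis by (simp add: algebra_simps)
    qed
  qed
  then show ?thesis by (simp add: y_def)
qed

text \<open>To the left of the diagonal the swap of coordinates leads back to \<open>cone 0\<close>,
  so the horizontal slope there is \<open>q 0\<close>; moves shorter than \<open>x / 2\<close> keep
  within it.\<close>

lemma kink_diagonal:
  assumes "0 < x"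
  shows "\<not> psi differentiable (at (x, x))"
proof (rule not_differentiable_kink[where v = "(1, 0)" and a = "p 0" and b = "q 0"])
  show "0 < x / 2" using assms by simp
  show "q 0 < p 0" by (rule q0_less_p0)
  have cone0: "psi (s, t) = p 0 * s + q 0 * t" if "t \<le> s" "s \<le> 2 * t" for s t
    using limit_metric_cone[of 0 t s] that by simp
  fix t :: real
  show "psi (x, x) + p 0 * t \<le> psi ((x, x) + t *\<^sub>R (1, 0))" if "0 < t" "t < x / 2"
    using that assms cone0[of x x] cone0[of x "x + t"] by (simp add: algebra_simps)
  show "psi (x, x) + q 0 * t \<le> psi ((x, x) + t *\<^sub>R (1, 0))" if "- (x / 2) < t" "t < 0"
    using that assms cone0[of x x] cone0[of "x + t" x] limit_metric_reflect(3)[of x "x + t"]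
    by (simp add: algebra_simps)
qed

lemma cone_exists:
  assumes "0 < y" "y \<le> x"
  obtains k where "(real k + 1) * y \<le> x" "x \<le> (real k + 2) * y"
proof -
  define k where "k = nat (\<lfloor>x / y\<rfloor> - 1)"
  have "1 \<le> x / y" using assms by simp
  then have "1 \<le> \<lfloor>x / y\<rfloor>" by simp
  then have "real k + 1 = real_of_int \<lfloor>x / y\<rfloor>" by (simp add: k_def)
  then have "real k + 1 \<le> x / y" "x / y \<le> real k + 2" by linarith+
  then show ?thesis using that assms by (simp add: field_simps)
qed

text \<open>Each \<open>c k\<close> is at least \<open>k + 1 + (L - gap)\<close>. The excess does
  not depend on \<open>k\<close>, which is essential because all large \<open>k\<close> occur near
  the axis; it becomes the one-sided slope of the kink.\<close>

lemma psi_above_axis: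
  assumes "0 < y" "y \<le> x"
  shows "x + (L - gap) * y \<le> psi (x, y)"
proof -
  obtain k where k: "(real k + 1) * y \<le> x" "x \<le> (real k + 2) * y"
    using cone_exists[OF assms] by blast
  have c_ge: "real k + 1 + (L - gap) \<le> c k" for k
    using hyp_ge(1)[of "real k + \<rho>" gap] by (simp add: c_def)
  have "((real k + 2) * y - x) * (real k + 1 + (L - gap)) + (x - (real k + 1) * y) * (real (Suc k) + 1 + (L - gap))
      \<le> ((real k + 2) * y - x) * c k + (x - (real k + 1) * y) * c (Suc k)"
    using k by (intro add_mono mult_left_mono c_ge) auto
  also have "\<dots> = psi (x, y)" using limit_metric_cone[OF k] by (simp add: cone_value)
  finally show ?thesis by (simp add: algebra_simps)
qed

lemma kink_axis:
  assumes "0 < x"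
  shows "\<not> psi differentiable (at (x, 0))"
proof (rule not_differentiable_kink[where v = "(0, 1)" and a = "L - gap" and b = "- (L - gap)"])
  show "0 < x" by fact
  show "- (L - gap) < L - gap" using L_bounds by simp
  fix t :: real
  show "psi (x, 0) + (L - gap) * t \<le> psi ((x, 0) + t *\<^sub>R (0, 1))" if "0 < t" "t < x"
    using psi_above_axis[of t x] that assms by (simp add: limit_metric_axis)
  show "psi (x, 0) + - (L - gap) * t \<le> psi ((x, 0) + t *\<^sub>R (0, 1))" if "- x < t" "t < 0"
    using psi_above_axis[of "- t" x] that assms limit_metric_reflect(2)[of x "- t"]
    by (simp add: limit_metric_axis algebra_simps)
qed

text \<open>The eight symmetries of the square: an optional swap of coordinates followed by two sign
  changes.\<close>

definition signed_swap :: "bool \<times> bool \<times> bool \<Rightarrow> real \<times> real \<Rightarrow> real \<times> real" where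
  "signed_swap = (\<lambda>(s, s', w) z.
     ((if s then - 1 else 1) * (if w then snd z else fst z),
      (if s' then - 1 else 1) * (if w then fst z else snd z)))"

definition cone :: "nat \<Rightarrow> (real \<times> real) set" where
  "cone k = {z. (real k + 1) * snd z \<le> fst z \<and> fst z \<le> (real k + 2) * snd z}"

text \<open>The half-axis at which the cones accumulate without covering it.\<close>

definition ray :: "(real \<times> real) set" where
  "ray = {z. snd z = 0 \<and> 0 \<le> fst z}"

lemma polyhedron_cone: "polyhedron (cone k)"
proof -
  have "cone k = {z. (- 1, real k + 1) \<bullet> z \<le> 0} \<inter> {z. (1, - (real k + 2)) \<bullet> z \<le> 0}"
    by (auto simp: cone_def inner_prod_def algebra_simps)
  then show ?thesis by (metis polyhedron_Int polyhedron_halfspace_le)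
qed

lemma polyhedron_ray: "polyhedron ray"
proof -
  have "ray = {z. (0, 1) \<bullet> z \<le> 0} \<inter> {z. (0, - 1) \<bullet> z \<le> 0} \<inter> {z. (- 1, 0) \<bullet> z \<le> 0}"
    by (auto simp: ray_def inner_prod_def)
  then show ?thesis by (metis polyhedron_Int polyhedron_halfspace_le)
qed

lemma psi_signed_swap: "psi (signed_swap g z) = psi z"
  by (cases g; cases z) (auto simp: signed_swap_def limit_metric_reflect)

lemma signed_swap_inner: "signed_swap g a \<bullet> signed_swap g z = a \<bullet> z"
  by (cases g; cases a; cases z) (auto simp: signed_swap_def inner_prod_def)

lemma linear_signed_swap: "linear (signed_swap g)"
  by (cases g) (auto simp: signed_swap_def algebra_simps intro!: linearI)

lemma bij_signed_swap: "bij (signed_swap g)"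
  by (rule orthogonal_transformation_bij)
     (simp add: orthogonal_transformation_def linear_signed_swap signed_swap_inner)

lemma signed_swap_surj:
  obtains g x y where "z = signed_swap g (x, y)" "0 \<le> y" "y \<le> x"
proof -
  let ?w = "\<bar>fst z\<bar> < \<bar>snd z\<bar>"
  have "z = signed_swap (fst z < 0, snd z < 0, ?w)
      (if ?w then \<bar>snd z\<bar> else \<bar>fst z\<bar>, if ?w then \<bar>fst z\<bar> else \<bar>snd z\<bar>)"
    by (cases z) (auto simp: signed_swap_def)
  then show ?thesis by (rule that) auto
qed

lemma piecewise_affine_psi: "piecewise_affine psi"
proof -
  let ?B = "insert ray (range cone)"
  let ?P = "(\<lambda>(g, B). signed_swap g ` B) ` (UNIV \<times> ?B)"
  have count: "countable ?P" by (intro countable_image countable_SIGMA) auto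
  have poly: "polyhedron P" if "P \<in> ?P" for P
    using that by (auto simp: polyhedron_linear_image_eq[OF linear_signed_swap bij_signed_swap]
        polyhedron_cone polyhedron_ray)
  have cover: "\<Union>?P = UNIV"
  proof -
    have "z \<in> \<Union>?P" for z
    proof -
      obtain g x y where z: "z = signed_swap g (x, y)" "0 \<le> y" "y \<le> x"
        using signed_swap_surj by metis
      have "\<exists>B\<in>?B. (x, y) \<in> B"
      proof (cases "y = 0")
        case True
        then show ?thesis using z by (auto simp: ray_def)
      next
        case False
        then obtain k where "(real k + 1) * y \<le> x" "x \<le> (real k + 2) * y"
          using cone_exists[of y x] z by auto
        then have "(x, y) \<in> cone k" by (simp add: cone_def)
        then show ?thesis by blast
      qed
      then obtain B where "B \<in> ?B" "(x, y) \<in> B" by blast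
      then show ?thesis using z(1) by (intro UnionI[of "signed_swap g ` B"] image_eqI[of _ _ "(g, B)"]) auto
    qed
    then show ?thesis by blast
  qed
  have affine: "\<exists>a b. \<forall>z\<in>P. psi z = a \<bullet> z + b" if P: "P \<in> ?P" for P
  proof -
    have "\<exists>g. \<exists>B\<in>?B. P = signed_swap g ` B" using P by fast
    then obtain g B where B: "B \<in> ?B" "P = signed_swap g ` B" by blast
    have "\<exists>a. \<forall>z\<in>B. psi z = a \<bullet> z"
    proof (cases "B = ray")
      case True
      have "\<forall>z\<in>ray. psi z = (1, 0) \<bullet> z"
        by (auto simp: ray_def limit_metric_axis inner_prod_def)
      then show ?thesis using True by blast
    next
      case False
      then obtain k where "B = cone k" using B(1) by auto
      moreover have "\<forall>z\<in>cone k. psi z = (p k, q k) \<bullet> z"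
        by (auto simp: cone_def limit_metric_cone inner_prod_def)
      ultimately show ?thesis by blast
    qed
    then obtain a where a: "\<And>z. z \<in> B \<Longrightarrow> psi z = a \<bullet> z" by blast
    \<comment> \<open>The symmetries preserve inner products, so the gradient on the image of a
      piece is the image of its gradient.\<close>
    have "psi z = signed_swap g a \<bullet> z + 0" if "z \<in> P" for z
      using that a by (auto simp: B(2) psi_signed_swap signed_swap_inner)
    then show ?thesis by blast
  qed
  show ?thesis
    unfolding piecewise_affine_def by (intro exI[of _ ?P] conjI ballI count poly cover affine)
qed

end

theorem lemma3p2:
  fixes \<rho> \<beta> :: real
  assumes "1 / 2 < \<rho>" and "\<rho> < 1" and "2 < \<beta>"
  shows "(\<forall>k::nat. \<forall>x::real. 1 \<le> k \<and> 0 < x \<longrightarrow>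
            \<not> limit_metric \<rho> \<beta> differentiable (at (x, x / (real k + 1)))) \<and>
         (\<forall>x::real. 0 < x \<longrightarrow> \<not> limit_metric \<rho> \<beta> differentiable (at (x, x))) \<and>
         (\<forall>x::real. 0 < x \<longrightarrow> \<not> limit_metric \<rho> \<beta> differentiable (at (x, 0))) \<and>
         piecewise_affine (limit_metric \<rho> \<beta>)"
proof -
  interpret obstacles \<rho> \<beta> by unfold_locales (fact assms)+
  show ?thesis using kink_line kink_diagonal kink_axis piecewise_affine_psi by blast
qed

end
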